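(* Let $\mathfrak A$ be a countable homogeneous $\omega$-categorical Ramsey structure. Then $\mathfrak A$ contains two independent elementary substructures.
   Context: All structures are relational. A structure is homogeneous if every isomorphism between finite substructures extends to an automorphism. It is $\omega$-categorical if its first-order theory has exactly one countable model up to isomorphism. For structures $\mathfrak X,\mathfrak Y$ in the same signature, $\binom{\mathfrak Y}{\mathfrak X}$ is the set of embeddings of $\mathfrak X$ into $\mathfrak Y$; $\mathfrak Z\to(\mathfrak Y)^{\mathfrak X}_r$ means that for every $\chi\colon\binom{\mathfrak Z}{\mathfrak X}\to\{1,\dots,r\}$ there is $e\in\binom{\mathfrak Z}{\mathfrak Y}$ such that $\chi$ is constant on $\{e\circ f: f\in\binom{\mathfrak Y}{\mathfrak X}\}$. A homogeneous structure is Ramsey if its age $\mathcal K$ (the class of finite structures embedding into it) satisfies: for all $\mathfrak X,\mathfrak Y\in\mathcal K$, $r\in\mathbb N$ there is $\mathfrak Z\in\mathcal K$ with $\mathfrak Z\to(\mathfrak Y)^{\mathfrak X}_r$. $\operatorname{typ}^{\mathfrak A}(a)$ is the set of first-order formulas satisfied by the tuple $a$ in $\mathfrak A$; $\operatorname{typ}^{\mathfrak A}(a/B)$ is the set of first-order formulas with parameters from $B\subseteq A$ satisfied by $a$. For $X,Y\subseteq A$, $X$ is independent from $Y$ in $\mathfrak A$ if for all $n$ and $\bar a,\bar b\in X^n$, $\operatorname{typ}^{\mathfrak A}(\bar a)=\operatorname{typ}^{\mathfrak A}(\bar b)$ implies $\operatorname{typ}^{\mathfrak A}(\bar a/Y)=\operatorname{typ}^{\mathfrak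 A}(\bar b/Y)$. Two substructures are independent if the domain of each is independent from the domain of the other in $\mathfrak A$. A substructure of $\mathfrak A$ is elementary if its inclusion map into $\mathfrak A$ preserves all first-order formulas.
   Formalization: The signature of 𝔄 is assumed countable, the usual convention for ω-categoricity; for uncountable signatures the literal claim fails (e.g. the ordered rational Urysohn space with all relations invariant under its automorphisms). *)

theory Defs
  imports "HOL-Library.FuncSet" "HOL-Library.Countable_Set"
begin

text \<open>A relational signature is a partial map: its domain is the set of relation symbols
  (possibly empty), its values are the arities.\<close>

type_synonym 'r signature = "'r \<Rightarrow> nat option"

record ('a, 'r) fo_struct =
  carrier :: "'a set"
  rel :: "'r \<Rightarrow> 'a list set"

text \<open>Every \<open>R\<close> outside the signature is interpreted by the empty set.\<close>

definition is_struct :: "'r signature \<Rightarrow> ('a, 'r) fo_struct \<Rightarrow> bool" where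
  "is_struct \<sigma> A \<longleftrightarrow>
     (\<forall>R. \<forall>xs \<in> rel A R. \<sigma> R = Some (length xs) \<and> set xs \<subseteq> carrier A)"

definition restrict_struct :: "('a, 'r) fo_struct \<Rightarrow> 'a set \<Rightarrow> ('a, 'r) fo_struct" where
  "restrict_struct A B = \<lparr>carrier = B, rel = (\<lambda>R. {xs \<in> rel A R. set xs \<subseteq> B})\<rparr>"

definition substructure :: "('a, 'r) fo_struct \<Rightarrow> ('a, 'r) fo_struct \<Rightarrow> bool" where
  "substructure B A \<longleftrightarrow> carrier B \<subseteq> carrier A \<and> B = restrict_struct A (carrier B)"

text \<open>Embeddings are taken extensional, so that two of them are equal as soon as they
  agree on the domain.\<close>

definition embeddings ::
    "('a, 'r) fo_struct \<Rightarrow> ('b, 'r) fo_struct \<Rightarrow> ('a \<Rightarrow> 'b) set" where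
  "embeddings X Y =
     {f \<in> carrier X \<rightarrow>\<^sub>E carrier Y. inj_on f (carrier X) \<and>
        (\<forall>R xs. set xs \<subseteq> carrier X \<longrightarrow> (xs \<in> rel X R \<longleftrightarrow> map f xs \<in> rel Y R))}"

definition isomorphisms ::
    "('a, 'r) fo_struct \<Rightarrow> ('b, 'r) fo_struct \<Rightarrow> ('a \<Rightarrow> 'b) set" where
  "isomorphisms X Y = {f \<in> embeddings X Y. f ` carrier X = carrier Y}"

definition homogeneous :: "('a, 'r) fo_struct \<Rightarrow> bool" where
  "homogeneous A \<longleftrightarrow>
     (\<forall>B C. substructure B A \<and> finite (carrier B) \<and> substructure C A \<and> finite (carrier C) \<longrightarrow>
        (\<forall>f \<in> isomorphisms B C. \<exists>g \<in> isomorphisms A A. \<forall>x \<in> carrier B. g x = f x))"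


subsection \<open>The Ramsey property\<close>

text \<open>Every member of the age has an isomorphic copy inside the structure itself, so it is
  enough to let the age range over structures on the same type \<open>'a\<close>.\<close>

definition age :: "'r signature \<Rightarrow> ('a, 'r) fo_struct \<Rightarrow> ('a, 'r) fo_struct set" where
  "age \<sigma> A = {X. is_struct \<sigma> X \<and> finite (carrier X) \<and> embeddings X A \<noteq> {}}"

text \<open>\<open>arrows Z Y X r\<close> is the partition relation \<open>Z \<rightarrow> (Y)\<^sup>X\<^sub>r\<close>.\<close>

definition arrows ::
    "('a, 'r) fo_struct \<Rightarrow> ('a, 'r) fo_struct \<Rightarrow> ('a, 'r) fo_struct \<Rightarrow> nat \<Rightarrow> bool" where
  "arrows Z Y X r \<longleftrightarrow>
     (\<forall>\<chi> \<in> embeddings X Z \<rightarrow> {1..r}. \<exists>e \<in> embeddings Y Z. \<exists>c.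
        \<forall>f \<in> embeddings X Y. \<chi> (compose (carrier X) e f) = c)"

definition ramsey :: "'r signature \<Rightarrow> ('a, 'r) fo_struct \<Rightarrow> bool" where
  "ramsey \<sigma> A \<longleftrightarrow>
     (\<forall>X \<in> age \<sigma> A. \<forall>Y \<in> age \<sigma> A. \<forall>r. \<exists>Z \<in> age \<sigma> A. arrows Z Y X r)"


subsection \<open>First-order logic\<close>

datatype 'r fm =
    Eq nat nat
  | Rel 'r "nat list"
  | Neg "'r fm"
  | Conj "'r fm" "'r fm"
  | Ex nat "'r fm"

primrec fv :: "'r fm \<Rightarrow> nat set" where
  "fv (Eq x y) = {x, y}"
| "fv (Rel R xs) = set xs"
| "fv (Neg \<phi>) = fv \<phi>"
| "fv (Conj \<phi> \<psi>) = fv \<phi> \<union> fv \<psi>"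
| "fv (Ex x \<phi>) = fv \<phi> - {x}"

primrec wf_fm :: "'r signature \<Rightarrow> 'r fm \<Rightarrow> bool" where
  "wf_fm \<sigma> (Eq x y) \<longleftrightarrow> True"
| "wf_fm \<sigma> (Rel R xs) \<longleftrightarrow> \<sigma> R = Some (length xs)"
| "wf_fm \<sigma> (Neg \<phi>) \<longleftrightarrow> wf_fm \<sigma> \<phi>"
| "wf_fm \<sigma> (Conj \<phi> \<psi>) \<longleftrightarrow> wf_fm \<sigma> \<phi> \<and> wf_fm \<sigma> \<psi>"
| "wf_fm \<sigma> (Ex x \<phi>) \<longleftrightarrow> wf_fm \<sigma> \<phi>"

primrec sat :: "('a, 'r) fo_struct \<Rightarrow> (nat \<Rightarrow> 'a) \<Rightarrow> 'r fm \<Rightarrow> bool" where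
  "sat A v (Eq x y) \<longleftrightarrow> v x = v y"
| "sat A v (Rel R xs) \<longleftrightarrow> map v xs \<in> rel A R"
| "sat A v (Neg \<phi>) \<longleftrightarrow> \<not> sat A v \<phi>"
| "sat A v (Conj \<phi> \<psi>) \<longleftrightarrow> sat A v \<phi> \<and> sat A v \<psi>"
| "sat A v (Ex x \<phi>) \<longleftrightarrow> (\<exists>d \<in> carrier A. sat A (v(x := d)) \<phi>)"

text \<open>The formulas with free variables among \<open>0, \<dots>, n - 1\<close>.  Tuples are lists, and a tuple
  \<open>a\<close> of length \<open>n\<close> interprets variable \<open>i < n\<close> by \<open>a ! i\<close>; the values of \<open>(!) a\<close> beyond
  \<open>n\<close> are unspecified, but irrelevant for these formulas.\<close>

definition formulas :: "'r signature \<Rightarrow> nat \<Rightarrow> 'r fm set" where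
  "formulas \<sigma> n = {\<phi>. wf_fm \<sigma> \<phi> \<and> fv \<phi> \<subseteq> {..<n}}"

abbreviation holds :: "('a, 'r) fo_struct \<Rightarrow> 'r fm \<Rightarrow> 'a list \<Rightarrow> bool" where
  "holds A \<phi> a \<equiv> sat A ((!) a) \<phi>"

definition theory_of :: "'r signature \<Rightarrow> ('a, 'r) fo_struct \<Rightarrow> 'r fm set" where
  "theory_of \<sigma> A = {\<phi> \<in> formulas \<sigma> 0. holds A \<phi> []}"

definition models :: "'r signature \<Rightarrow> 'r fm set \<Rightarrow> ('a, 'r) fo_struct set" where
  "models \<sigma> T = {M. is_struct \<sigma> M \<and> (\<forall>\<phi> \<in> T. holds M \<phi> [])}"

text \<open>Up to isomorphism, the countable structures are those whose domain is a set of natural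
  numbers.  Countable includes finite.\<close>

definition omega_categorical :: "'r signature \<Rightarrow> ('a, 'r) fo_struct \<Rightarrow> bool" where
  "omega_categorical \<sigma> A \<longleftrightarrow>
     (\<exists>M :: (nat, 'r) fo_struct. M \<in> models \<sigma> (theory_of \<sigma> A) \<and>
        (\<forall>N :: (nat, 'r) fo_struct. N \<in> models \<sigma> (theory_of \<sigma> A) \<longrightarrow> isomorphisms N M \<noteq> {}))"

definition elementary_substructure ::
    "'r signature \<Rightarrow> ('a, 'r) fo_struct \<Rightarrow> ('a, 'r) fo_struct \<Rightarrow> bool" where
  "elementary_substructure \<sigma> B A \<longleftrightarrow> substructure B A \<and>
     (\<forall>n. \<forall>\<phi> \<in> formulas \<sigma> n. \<forall>a. length a = n \<and> set a \<subseteq> carrier B \<longrightarrow>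
        holds B \<phi> a \<longrightarrow> holds A \<phi> a)"


subsection \<open>Types and independence\<close>

definition type_of :: "'r signature \<Rightarrow> ('a, 'r) fo_struct \<Rightarrow> 'a list \<Rightarrow> 'r fm set" where
  "type_of \<sigma> A a = {\<phi> \<in> formulas \<sigma> (length a). holds A \<phi> a}"

text \<open>A formula with parameters from \<open>B\<close> is a pair of a formula and a tuple \<open>b\<close> of elements
  of \<open>B\<close>, which is substituted for the variables following those for \<open>a\<close>.\<close>

definition type_over ::
    "'r signature \<Rightarrow> ('a, 'r) fo_struct \<Rightarrow> 'a list \<Rightarrow> 'a set \<Rightarrow> ('r fm \<times> 'a list) set" where
  "type_over \<sigma> A a B =
     {(\<phi>, b). \<phi> \<in> formulas \<sigma> (length a + length b) \<and> set b \<subseteq> B \<and> holds A \<phi> (a @ b)}"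

definition independent_from ::
    "'r signature \<Rightarrow> ('a, 'r) fo_struct \<Rightarrow> 'a set \<Rightarrow> 'a set \<Rightarrow> bool" where
  "independent_from \<sigma> A X Y \<longleftrightarrow>
     (\<forall>n a b. length a = n \<and> set a \<subseteq> X \<and> length b = n \<and> set b \<subseteq> X \<longrightarrow>
        type_of \<sigma> A a = type_of \<sigma> A b \<longrightarrow> type_over \<sigma> A a Y = type_over \<sigma> A b Y)"

definition independent_substructures ::
    "'r signature \<Rightarrow> ('a, 'r) fo_struct \<Rightarrow> ('a, 'r) fo_struct \<Rightarrow> ('a, 'r) fo_struct \<Rightarrow> bool" where
  "independent_substructures \<sigma> A B C \<longleftrightarrow>
     independent_from \<sigma> A (carrier B) (carrier C) \<and> independent_from \<sigma> A (carrier C) (carrier B)"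

end

theory Submission imports Defs begin

text \<open>
  By homogeneity, two tuples of \<open>A\<close> have the same type exactly when an automorphism carries one to
  the other (\<open>type_eq_orb\<close>).  Hence a set \<open>P\<close> is independent from \<open>Q\<close> as soon as conjugate tuples
  of \<open>P\<close> remain conjugate after any tuple of \<open>Q\<close> has been appended to both; this is a condition
  on finite subsets, and it is invariant under automorphisms.

  \<^item> Finite sets.  Let \<open>S\<close> be finite and \<open>c\<close> a tuple.  Colour the copies \<open>y\<close> of a tuple \<open>x\<close> of \<open>S\<close>
    by the type of \<open>y @ c\<close>.  There are only finitely many colours, so the Ramsey property moves
    \<open>S\<close> to a place where all copies of \<open>x\<close> have the same colour.  When this has been done
    for every \<open>x\<close> without repetitions, the image of \<open>S\<close> is independent from \<open>c\<close>.  Moreover, the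
    image can be found in a finite set \<open>Z\<close> that depends only on \<open>S\<close> and the length of \<open>c\<close>
    (\<open>copy_independent_from_tuple\<close>), and this makes independence mutual: choose \<open>Z\<close> for tuples of
    length \<open>card S\<close>, move \<open>S\<close> to a copy \<open>S\<^sub>1\<close> independent from all of \<open>Z\<close>, and then find in \<open>Z\<close> a
    copy \<open>S\<^sub>2\<close> independent from \<open>S\<^sub>1\<close> (\<open>independent_copies\<close>).

  \<^item> Passage to the limit.  Enumerate \<open>A\<close> as \<open>a\<^sub>0, a\<^sub>1, \<dots>\<close> and apply the above to the first \<open>n\<close>
    points, for every \<open>n\<close>.  As there are finitely many orbits of tuples of each length, Koenig's
    argument yields a single pair of sequences all of whose initial segments are conjugate to
    initial segments of such finite pairs (\<open>sequence_compactness\<close>).  The sets of their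
    values are elementary substructures, because initial segments are conjugate to
    initial segments of the enumeration of \<open>A\<close> (\<open>elementary_copy\<close>).

  \<^item> Finitely many types.  That an \<open>\<omega>\<close>-categorical structure has finitely many types of tuples of
    each length is the theorem of Ryll-Nardzewski (\<open>finite_types\<close>).  Since a countable elementary
    substructure of an ultrapower of \<open>A\<close> is isomorphic to \<open>A\<close>, every sequence of tuples of
    \<open>A\<close> accumulates at the type of a tuple of \<open>A\<close> (\<open>accumulation_tuple\<close>).  By diagonalisation, the
    isolated types are therefore dense (\<open>isolated_dense\<close>), so that \<open>A\<close> has an elementary substructure
    in which every tuple has an isolated type.  It is isomorphic to \<open>A\<close>, so
    all types are isolated in \<open>A\<close>, and infinitely many of them could not accumulate anywhere.
\<close>

section \<open>Formulas\<close>

lemma finite_fv: "finite (fv \<phi>)"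
  by (induction \<phi>) auto

lemma sat_cong:
  assumes "\<And>i. i \<in> fv \<phi> \<Longrightarrow> v i = w i"
  shows "sat A v \<phi> \<longleftrightarrow> sat A w \<phi>"
  using assms
proof (induction \<phi> arbitrary: v w)
  case (Rel R xs)
  then have "map v xs = map w xs" by simp
  then show ?case by (simp del: map_eq_conv)
next
  case (Conj \<phi> \<psi>)
  from Conj.IH(1)[of v w] Conj.IH(2)[of v w] Conj.prems show ?case by simp
next
  case (Ex x \<phi>)
  have "sat A (v(x := d)) \<phi> \<longleftrightarrow> sat A (w(x := d)) \<phi>" for d
    using Ex.prems by (intro Ex.IH) auto
  then show ?case by simp
next
  case (Neg \<phi>)
  from Neg.IH[of v w] Neg.prems show ?case by simp
qed auto

text \<open>Bound variables are renamed to avoid the values of \<open>p\<close>, so substitution is correct for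
  arbitrary, even non-injective, \<open>p\<close> (see \<open>sat_subst_fm\<close>).\<close>

primrec subst_fm :: "(nat \<Rightarrow> nat) \<Rightarrow> 'r fm \<Rightarrow> 'r fm" where
  "subst_fm p (Eq x y) = Eq (p x) (p y)"
| "subst_fm p (Rel R xs) = Rel R (map p xs)"
| "subst_fm p (Neg \<phi>) = Neg (subst_fm p \<phi>)"
| "subst_fm p (Conj \<phi> \<psi>) = Conj (subst_fm p \<phi>) (subst_fm p \<psi>)"
| "subst_fm p (Ex x \<phi>) =
     (let z = (LEAST z. z \<notin> p ` fv \<phi>) in Ex z (subst_fm (p(x := z)) \<phi>))"

lemma fresh_variable: "(LEAST z. z \<notin> p ` fv \<phi>) \<notin> p ` fv \<phi>" for p :: "nat \<Rightarrow> nat"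
proof -
  have "\<exists>z. z \<notin> p ` fv \<phi>"
    using finite_fv[of \<phi>] by (simp add: ex_new_if_finite)
  then show ?thesis by (rule LeastI_ex)
qed

lemma wf_subst_fm [simp]: "wf_fm \<sigma> (subst_fm p \<phi>) \<longleftrightarrow> wf_fm \<sigma> \<phi>"
  by (induction \<phi> arbitrary: p) (simp_all add: Let_def)

lemma fv_subst_fm: "fv (subst_fm p \<phi>) \<subseteq> p ` fv \<phi>"
proof (induction \<phi> arbitrary: p)
  case (Ex x \<phi>)
  define z where "z = (LEAST z. z \<notin> p ` fv \<phi>)"
  have "fv (subst_fm p (Ex x \<phi>)) = fv (subst_fm (p(x := z)) \<phi>) - {z}"
    by (simp add: z_def Let_def)
  also have "\<dots> \<subseteq> (p(x := z)) ` fv \<phi> - {z}" using Ex.IH by blast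
  also have "\<dots> \<subseteq> p ` fv (Ex x \<phi>)" by auto
  finally show ?case .
next
  case (Conj \<phi> \<psi>)
  then show ?case by (force simp: image_Un)
qed auto

lemma sat_subst_fm: "sat A v (subst_fm p \<phi>) \<longleftrightarrow> sat A (v \<circ> p) \<phi>"
proof (induction \<phi> arbitrary: p v)
  case (Ex x \<phi>)
  define z where "z = (LEAST z. z \<notin> p ` fv \<phi>)"
  have z: "z \<notin> p ` fv \<phi>" unfolding z_def by (rule fresh_variable)
  have "sat A ((v(z := d)) \<circ> (p(x := z))) \<phi> \<longleftrightarrow> sat A ((v \<circ> p)(x := d)) \<phi>" for d
    using z by (intro sat_cong) auto
  moreover have "subst_fm p (Ex x \<phi>) = Ex z (subst_fm (p(x := z)) \<phi>)"
    by (simp add: z_def Let_def)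
  ultimately show ?case by (simp only: sat.simps Ex.IH)
qed (auto simp: comp_def)

lemma wf_fm_symbols: "wf_fm \<sigma> \<phi> \<Longrightarrow> set_fm \<phi> \<subseteq> dom \<sigma>"
  by (induction \<phi>) auto

instance fm :: (countable) countable
  by countable_datatype

text \<open>The symbols may come from an uncountable type; those of a well-formed formula lie in the
  countable domain of \<open>\<sigma>\<close> and can be replaced by natural numbers.\<close>

lemma countable_wf_fm:
  assumes "countable (dom \<sigma>)"
  shows "countable {\<phi>. wf_fm \<sigma> \<phi>}"
proof -
  let ?h = "to_nat_on (dom \<sigma>)"
  have "inj_on (map_fm ?h) {\<phi>. wf_fm \<sigma> \<phi>}"
  proof (rule inj_onI)
    fix \<phi> \<psi> :: "'a fm"
    assume "\<phi> \<in> {\<phi>. wf_fm \<sigma> \<phi>}" "\<psi> \<in> {\<phi>. wf_fm \<sigma> \<phi>}" and eq: "map_fm ?h \<phi> = map_fm ?h \<psi>"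
    then have sub: "set_fm \<phi> \<subseteq> dom \<sigma>" "set_fm \<psi> \<subseteq> dom \<sigma>"
      by (auto dest: wf_fm_symbols)
    show "\<phi> = \<psi>"
    proof (rule fm.inj_map_strong[OF _ eq])
      fix x y assume "x \<in> set_fm \<phi>" "y \<in> set_fm \<psi>" "?h x = ?h y"
      then show "x = y"
        using sub inj_on_to_nat_on[OF assms] by (auto dest: inj_onD)
    qed
  qed
  then show ?thesis
    by (rule countableI')
qed

lemma holds_cong:
  assumes "\<phi> \<in> formulas \<sigma> n" "\<And>i. i < n \<Longrightarrow> v i = w i"
  shows "sat A v \<phi> \<longleftrightarrow> sat A w \<phi>"
  using assms by (intro sat_cong) (auto simp: formulas_def)

section \<open>Isomorphisms\<close>

text \<open>Isomorphisms as in \<open>isomorphisms\<close>, but with arbitrary values outside the domain, so that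
  ordinary composition and identity can be used.\<close>

definition is_iso :: "('a, 'r) fo_struct \<Rightarrow> ('b, 'r) fo_struct \<Rightarrow> ('a \<Rightarrow> 'b) \<Rightarrow> bool" where
  "is_iso X Y f \<longleftrightarrow> bij_betw f (carrier X) (carrier Y) \<and>
     (\<forall>R xs. set xs \<subseteq> carrier X \<longrightarrow> (xs \<in> rel X R \<longleftrightarrow> map f xs \<in> rel Y R))"

lemma isomorphisms_is_iso: "f \<in> isomorphisms X Y \<Longrightarrow> is_iso X Y f"
  by (auto simp: isomorphisms_def embeddings_def is_iso_def bij_betw_def)

lemma is_iso_id: "is_iso X X (\<lambda>x. x)"
  by (simp add: is_iso_def bij_betw_def)

lemma is_iso_comp: "is_iso X Y f \<Longrightarrow> is_iso Y Z g \<Longrightarrow> is_iso X Z (g \<circ> f)"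
  unfolding is_iso_def
  apply (intro conjI allI impI)
   apply (blast intro: bij_betw_trans)
  by (metis (no_types, lifting) bij_betw_imp_surj_on image_mono list.map_comp list.set_map)

lemma is_iso_inv:
  assumes "is_iso X Y f"
  shows "is_iso Y X (inv_into (carrier X) f)"
proof -
  let ?g = "inv_into (carrier X) f"
  have b: "bij_betw f (carrier X) (carrier Y)" using assms by (simp add: is_iso_def)
  have g: "bij_betw ?g (carrier Y) (carrier X)" by (rule bij_betw_inv_into[OF b])
  have "ys \<in> rel Y R \<longleftrightarrow> map ?g ys \<in> rel X R" if "set ys \<subseteq> carrier Y" for R ys
  proof -
    have "set (map ?g ys) \<subseteq> carrier X"
      using that g by (auto simp: bij_betw_def)
    moreover have "map f (map ?g ys) = ys"
      using that b by (auto simp: map_idI bij_betw_inv_into_right subset_eq)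
    ultimately show ?thesis using assms unfolding is_iso_def by metis
  qed
  with g show ?thesis by (simp add: is_iso_def)
qed

lemma is_iso_in: "is_iso X Y f \<Longrightarrow> x \<in> carrier X \<Longrightarrow> f x \<in> carrier Y"
  by (auto simp: is_iso_def bij_betw_def)

lemma is_iso_sat:
  assumes f: "is_iso X Y f" and v: "\<And>i. v i \<in> carrier X"
  shows "sat X v \<phi> \<longleftrightarrow> sat Y (f \<circ> v) \<phi>"
  using v
proof (induction \<phi> arbitrary: v)
  case (Eq x y)
  then show ?case using f by (auto simp: is_iso_def bij_betw_def dest: inj_onD)
next
  case (Rel R xs)
  have "map v xs \<in> rel X R \<longleftrightarrow> map f (map v xs) \<in> rel Y R"
    using f Rel unfolding is_iso_def by (metis (no_types, lifting) image_subsetI list.set_map)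
  then show ?case by (simp add: comp_def)
next
  case (Ex x \<phi>)
  have im: "carrier Y = f ` carrier X" using f by (auto simp: is_iso_def bij_betw_def)
  have "sat X (v(x := d)) \<phi> \<longleftrightarrow> sat Y ((f \<circ> v)(x := f d)) \<phi>" if "d \<in> carrier X" for d
  proof -
    have "f \<circ> v(x := d) = (f \<circ> v)(x := f d)" by auto
    moreover have "sat X (v(x := d)) \<phi> \<longleftrightarrow> sat Y (f \<circ> v(x := d)) \<phi>"
      by (rule Ex.IH) (simp add: Ex.prems that)
    ultimately show ?thesis by (simp only:)
  qed
  then show ?case unfolding sat.simps im by blast
qed auto

text \<open>The list \<open>a\<close> as an assignment whose values are all in the domain, as required by
  \<open>is_iso_sat\<close> and the other facts on satisfaction under assignments.\<close>

definition pad :: "'a \<Rightarrow> 'a list \<Rightarrow> nat \<Rightarrow> 'a" where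
  "pad d a i = (if i < length a then a ! i else d)"

lemma holds_pad: "\<phi> \<in> formulas \<sigma> (length a) \<Longrightarrow> holds A \<phi> a \<longleftrightarrow> sat A (pad d a) \<phi>"
  by (rule holds_cong[where n = "length a"]) (auto simp: pad_def)

lemma is_iso_holds:
  assumes f: "is_iso X Y f" and a: "set a \<subseteq> carrier X" and \<phi>: "\<phi> \<in> formulas \<sigma> (length a)"
    and ne: "carrier X \<noteq> {}"
  shows "holds X \<phi> a \<longleftrightarrow> holds Y \<phi> (map f a)"
proof -
  obtain d where d: "d \<in> carrier X" using ne by blast
  have "holds X \<phi> a \<longleftrightarrow> sat X (pad d a) \<phi>" by (rule holds_pad[OF \<phi>])
  also have "\<dots> \<longleftrightarrow> sat Y (f \<circ> pad d a) \<phi>"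
    using a d by (intro is_iso_sat[OF f]) (auto simp: pad_def)
  also have "\<dots> \<longleftrightarrow> holds Y \<phi> (map f a)"
    by (rule holds_cong[OF \<phi>]) (simp add: pad_def)
  finally show ?thesis .
qed

lemma type_of_is_iso:
  assumes "is_iso X Y f" "set a \<subseteq> carrier X" "carrier X \<noteq> {}"
  shows "type_of \<sigma> Y (map f a) = type_of \<sigma> X a"
  unfolding type_of_def using is_iso_holds[OF assms(1,2) _ assms(3), of _ \<sigma>] by auto

section \<open>Elementary substructures\<close>

text \<open>The only difference between satisfaction in a structure and in a subset of it is the range of
  the quantifiers; if witnesses can be found in the subset, this difference vanishes.\<close>

lemma tarski_vaught:
  assumes B: "B \<subseteq> carrier A"
    and witness: "\<And>\<phi> x v. wf_fm \<sigma> \<phi> \<Longrightarrow> (\<And>i. v i \<in> B) \<Longrightarrow> \<exists>d \<in> carrier A. sat A (v(x := d)) \<phi>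
                   \<Longrightarrow> \<exists>d \<in> B. sat A (v(x := d)) \<phi>"
    and \<phi>: "wf_fm \<sigma> \<phi>" and v: "\<And>i. v i \<in> B"
  shows "sat (restrict_struct A B) v \<phi> \<longleftrightarrow> sat A v \<phi>"
  using \<phi> v
proof (induction \<phi> arbitrary: v)
  case (Rel R xs)
  then show ?case by (auto simp: restrict_struct_def)
next
  case (Ex x \<phi>)
  have "sat (restrict_struct A B) (v(x := d)) \<phi> \<longleftrightarrow> sat A (v(x := d)) \<phi>" if "d \<in> B" for d
    using Ex that by (intro Ex.IH) auto
  then have "sat (restrict_struct A B) v (Ex x \<phi>) \<longleftrightarrow> (\<exists>d \<in> B. sat A (v(x := d)) \<phi>)"
    by (simp add: restrict_struct_def)
  also have "\<dots> \<longleftrightarrow> sat A v (Ex x \<phi>)"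
    using witness[of \<phi> v x] Ex.prems B by auto
  finally show ?case .
qed auto

lemma substructure_restrict: "B \<subseteq> carrier A \<Longrightarrow> substructure (restrict_struct A B) A"
  by (simp add: substructure_def restrict_struct_def)

lemma is_struct_restrict: "is_struct \<sigma> A \<Longrightarrow> is_struct \<sigma> (restrict_struct A B)"
  by (auto simp: is_struct_def restrict_struct_def)

lemma elementary_holds:
  assumes "B \<noteq> {}"
    and sat: "\<And>\<phi> v. wf_fm \<sigma> \<phi> \<Longrightarrow> (\<And>i. v i \<in> B) \<Longrightarrow> sat (restrict_struct A B) v \<phi> \<longleftrightarrow> sat A v \<phi>"
    and \<phi>: "\<phi> \<in> formulas \<sigma> (length a)" and a: "set a \<subseteq> B"
  shows "holds (restrict_struct A B) \<phi> a \<longleftrightarrow> holds A \<phi> a"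
proof -
  obtain d where "d \<in> B" using assms(1) by blast
  with a have "pad d a i \<in> B" for i by (auto simp: pad_def subset_eq)
  then have "sat (restrict_struct A B) (pad d a) \<phi> \<longleftrightarrow> sat A (pad d a) \<phi>"
    using \<phi> by (intro sat) (auto simp: formulas_def)
  then show ?thesis using holds_pad[OF \<phi>] by metis
qed

lemma elementary_substructureI:
  assumes "B \<subseteq> carrier A" "B \<noteq> {}"
    and "\<And>\<phi> v. wf_fm \<sigma> \<phi> \<Longrightarrow> (\<And>i. v i \<in> B) \<Longrightarrow> sat (restrict_struct A B) v \<phi> \<longleftrightarrow> sat A v \<phi>"
  shows "elementary_substructure \<sigma> (restrict_struct A B) A"
proof -
  have "holds A \<phi> a"
    if "\<phi> \<in> formulas \<sigma> (length a)" "set a \<subseteq> B" "holds (restrict_struct A B) \<phi> a" for \<phi> a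
    using elementary_holds[OF assms(2,3) that(1,2)] that(3) by blast
  then show ?thesis
    by (auto simp: elementary_substructure_def substructure_restrict[OF assms(1)])
      (simp add: restrict_struct_def)
qed

text \<open>Close the given set under a choice of witnesses for all formulas with parameters; there are only
  countably many formulas and finite tuples of parameters.\<close>

lemma downward_loewenheim_skolem:
  assumes \<sigma>: "countable (dom \<sigma>)" and S: "S \<subseteq> carrier A" "countable S"
  obtains B where "S \<subseteq> B" "B \<subseteq> carrier A" "countable B"
    "\<And>\<phi> v. wf_fm \<sigma> \<phi> \<Longrightarrow> (\<And>i. v i \<in> B) \<Longrightarrow> sat (restrict_struct A B) v \<phi> \<longleftrightarrow> sat A v \<phi>"
proof -
  define wit where "wit = (\<lambda>(\<phi>, x, a). SOME d. d \<in> carrier A \<and> sat A (((!) a)(x := d)) \<phi>)"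
  define step where "step = (\<lambda>T. T \<union> (wit ` ({\<phi>. wf_fm \<sigma> \<phi>} \<times> UNIV \<times> lists T) \<inter> carrier A))"
  define T where "T = (\<lambda>n. (step ^^ n) S)"
  have T: "T n \<subseteq> carrier A \<and> countable (T n)" for n
  proof (induction n)
    case (Suc n)
    have "countable ({\<phi>. wf_fm \<sigma> \<phi>} \<times> (UNIV :: nat set) \<times> lists (T n))"
      using Suc countable_wf_fm[OF \<sigma>] by auto
    with Suc show ?case by (auto simp: T_def step_def)
  qed (auto simp: T_def S)
  have mono: "T m \<subseteq> T n" if "m \<le> n" for m n
    by (rule lift_Suc_mono_le[OF _ that]) (auto simp: T_def step_def)
  define B where "B = (\<Union>n. T n)"
  have B: "B \<subseteq> carrier A" using T by (auto simp: B_def)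
  have witness: "\<exists>d \<in> B. sat A (v(x := d)) \<phi>"
    if \<phi>: "wf_fm \<sigma> \<phi>" and v: "\<And>i. v i \<in> B" and ex: "\<exists>d \<in> carrier A. sat A (v(x := d)) \<phi>" for \<phi> x v
  proof -
    obtain m where m: "fv \<phi> \<subseteq> {..<m}" using finite_fv[of \<phi>] finite_nat_bounded by blast
    have "\<exists>n. v i \<in> T n" for i using v by (auto simp: B_def)
    then obtain k where k: "\<And>i. v i \<in> T (k i)" by metis
    \<comment> \<open>\<open>Suc m\<close> keeps the set nonempty when \<open>m = 0\<close>.\<close>
    let ?K = "Max (k ` {..<Suc m})"
    have a: "map v [0..<m] \<in> lists (T ?K)"
    proof -
      have "v i \<in> T ?K" if "i < m" for i
        using k[of i] mono[of "k i" ?K] that by (auto intro!: Max_ge)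
      then show ?thesis by (auto simp: lists_eq_set)
    qed
    have eq: "sat A (((!) (map v [0..<m]))(x := d)) \<phi> \<longleftrightarrow> sat A (v(x := d)) \<phi>" for d
      using m by (intro sat_cong) auto
    let ?d = "wit (\<phi>, x, map v [0..<m])"
    have d: "?d \<in> carrier A \<and> sat A (v(x := ?d)) \<phi>"
      using someI_ex[of "\<lambda>d. d \<in> carrier A \<and> sat A (v(x := d)) \<phi>"] ex
      by (simp add: wit_def eq) blast
    then have "?d \<in> T (Suc ?K)" using \<phi> a by (auto simp: T_def step_def)
    with d show ?thesis by (auto simp: B_def)
  qed
  show thesis
  proof
    show "S \<subseteq> B" using mono[of 0] by (auto simp: B_def T_def intro: exI[of _ 0])
    show "countable B" using T by (auto simp: B_def)
    show "sat (restrict_struct A B) v \<phi> \<longleftrightarrow> sat A v \<phi>" if "wf_fm \<sigma> \<phi>" "\<And>i. v i \<in> B" for \<phi> v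
      by (rule tarski_vaught[OF B witness that])
  qed (rule B)
qed

section \<open>Ultrapowers\<close>

text \<open>A minimal proper filter below \<open>sequentially\<close>, found by Zorn's lemma: if neither \<open>P\<close> nor its
  negation held eventually, restricting the filter to \<open>P\<close> would give a smaller proper filter.\<close>

lemma ultrafilter_exists:
  obtains U :: "nat filter" where "U \<noteq> bot" "U \<le> sequentially"
    "\<And>P. eventually P U \<or> eventually (\<lambda>k. \<not> P k) U"
proof -
  let ?\<F> = "{F :: nat filter. F \<noteq> bot \<and> F \<le> sequentially}"
  have "\<exists>U \<in> ?\<F>. \<forall>F \<in> ?\<F>. F \<le> U \<longrightarrow> F = U"
  proof (rule predicate_Zorn[where P = "\<lambda>F G. G \<le> F"])
    show "partial_order_on ?\<F> (relation_of (\<lambda>F G. G \<le> F) ?\<F>)"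
      by (rule partial_order_on_relation_ofI) auto
    fix C assume C: "C \<in> Chains (relation_of (\<lambda>F G. G \<le> F) ?\<F>)"
    then have sub: "C \<subseteq> ?\<F>" and lin: "\<And>F G. F \<in> C \<Longrightarrow> G \<in> C \<Longrightarrow> F \<le> G \<or> G \<le> F"
      by (auto simp: Chains_def relation_of_def)
    show "\<exists>u \<in> ?\<F>. \<forall>F \<in> C. u \<le> F"
    proof (cases "C = {}")
      case True
      have "sequentially \<in> ?\<F>" by (auto simp: trivial_limit_def[symmetric])
      with True show ?thesis by blast
    next
      case False
      have least: "X \<noteq> {} \<Longrightarrow> X \<subseteq> C \<Longrightarrow> Inf X \<in> X" if "finite X" for X
        using that
      proof (induction X rule: finite_induct)
        case (insert F X)
        show ?case
        proof (cases "X = {}")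
          case False
          with insert have "Inf X \<in> X" "Inf X \<in> C" "F \<in> C" by auto
          with lin[of F "Inf X"] show ?thesis by (auto simp: inf_absorb1 inf_absorb2)
        qed simp
      qed simp
      have "Inf C \<noteq> bot"
      proof (rule Inf_filter_not_bot)
        fix X assume "X \<subseteq> C" "finite X"
        then show "Inf X \<noteq> bot"
          using least[of X] sub by (cases "X = {}") (auto simp: trivial_limit_def)
      qed
      moreover have "Inf C \<le> sequentially"
        using False sub by (auto intro: Inf_lower2)
      ultimately show ?thesis by (auto intro: Inf_lower)
    qed
  qed
  then obtain U where U: "U \<noteq> bot" "U \<le> sequentially"
    and max: "\<And>F. F \<noteq> bot \<Longrightarrow> F \<le> sequentially \<Longrightarrow> F \<le> U \<Longrightarrow> F = U" by auto
  have "eventually P U \<or> eventually (\<lambda>k. \<not> P k) U" for P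
  proof (cases "inf U (principal {k. P k}) = bot")
    case True
    then have "eventually (\<lambda>_. False) (inf U (principal {k. P k}))" by simp
    then show ?thesis by (simp add: eventually_inf_principal)
  next
    case False
    then have "inf U (principal {k. P k}) = U"
      using U(2) by (intro max) (auto intro: le_infI1)
    then have "U \<le> principal {k. P k}" by (metis inf.cobounded2)
    then show ?thesis by (simp add: le_principal)
  qed
  with U that show thesis by blast
qed

text \<open>A canonical member of the class of \<open>f\<close> modulo \<open>U\<close>.  The elements of the ultrapower are such
  representatives, so that they are functions rather than sets of functions.\<close>

definition representative ::
    "nat filter \<Rightarrow> ('a, 'r) fo_struct \<Rightarrow> (nat \<Rightarrow> 'a) \<Rightarrow> nat \<Rightarrow> 'a" where
  "representative U A f = (SOME g. (\<forall>k. g k \<in> carrier A) \<and> eventually (\<lambda>k. g k = f k) U)"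

definition ultrapower :: "nat filter \<Rightarrow> ('a, 'r) fo_struct \<Rightarrow> (nat \<Rightarrow> 'a, 'r) fo_struct" where
  "ultrapower U A =
     \<lparr>carrier = representative U A ` {f. \<forall>k. f k \<in> carrier A},
      rel = (\<lambda>R. {xs. set xs \<subseteq> representative U A ` {f. \<forall>k. f k \<in> carrier A} \<and>
                    eventually (\<lambda>k. map (\<lambda>f. f k) xs \<in> rel A R) U})\<rparr>"

lemma representative:
  assumes "\<And>k. f k \<in> carrier A"
  shows "representative U A f k \<in> carrier A" "eventually (\<lambda>k. representative U A f k = f k) U"
    "representative U A f \<in> carrier (ultrapower U A)"
proof -
  have "(\<forall>k. representative U A f k \<in> carrier A)
      \<and> eventually (\<lambda>k. representative U A f k = f k) U"
    unfolding representative_def by (rule someI[of _ f]) (use assms in auto)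
  then show "representative U A f k \<in> carrier A"
      "eventually (\<lambda>k. representative U A f k = f k) U" by auto
  show "representative U A f \<in> carrier (ultrapower U A)"
    using assms by (auto simp: ultrapower_def)
qed

lemma representative_cong:
  assumes "eventually (\<lambda>k. f k = g k) U"
  shows "representative U A f = representative U A g"
proof -
  have "eventually (\<lambda>k. h k = f k) U \<longleftrightarrow> eventually (\<lambda>k. h k = g k) U" for h
    by (rule eventually_subst) (use assms in eventually_elim, simp)
  then show ?thesis by (simp add: representative_def)
qed

lemma ultrapower_carrier:
  assumes "f \<in> carrier (ultrapower U A)"
  shows "f k \<in> carrier A" "representative U A f = f"
proof -
  obtain f' where f': "f = representative U A f'" "\<And>k. f' k \<in> carrier A"
    using assms by (auto simp: ultrapower_def)
  show "f k \<in> carrier A" using representative(1)[of f'] f' by auto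
  show "representative U A f = f"
    using representative_cong[OF representative(2)[of f' A U]] f' by simp
qed

text \<open>The theorem of Los: the filter commutes with negation because it is an ultrafilter, and with the
  existential quantifier because witnesses can be chosen in each coordinate separately.\<close>

lemma los:
  assumes U: "U \<noteq> bot" "\<And>P. eventually P U \<or> eventually (\<lambda>k. \<not> P k) U"
    and v: "\<And>i. v i \<in> carrier (ultrapower U A)"
  shows "sat (ultrapower U A) v \<phi> \<longleftrightarrow> eventually (\<lambda>k. sat A (\<lambda>i. v i k) \<phi>) U"
  using v
proof (induction \<phi> arbitrary: v)
  case (Eq x y)
  have "v x = v y" if "eventually (\<lambda>k. v x k = v y k) U"
    using representative_cong[OF that, of A] Eq
      ultrapower_carrier(2)[of "v x" U A] ultrapower_carrier(2)[of "v y" U A] by simp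
  then show ?case by auto
next
  case (Rel R xs)
  then show ?case by (auto simp: ultrapower_def comp_def)
next
  case (Neg \<phi>)
  have "\<not> eventually P U \<longleftrightarrow> eventually (\<lambda>k. \<not> P k) U" for P
  proof
    assume "eventually (\<lambda>k. \<not> P k) U"
    then show "\<not> eventually P U" using U(1)
      using eventually_conj_iff[of P "\<lambda>k. \<not> P k" U] by (auto simp: trivial_limit_def)
  qed (use U(2)[of P] in blast)
  then show ?case using Neg.IH[OF Neg.prems] by simp
next
  case (Conj \<phi> \<psi>)
  then show ?case by (simp add: eventually_conj_iff)
next
  case (Ex x \<phi>)
  have upd: "(\<lambda>i. (v(x := d)) i k) = (\<lambda>i. v i k)(x := d k)" for d k by auto
  have IH: "sat (ultrapower U A) (v(x := d)) \<phi>
      \<longleftrightarrow> eventually (\<lambda>k. sat A ((\<lambda>i. v i k)(x := d k)) \<phi>) U"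
    if "d \<in> carrier (ultrapower U A)" for d
    unfolding upd[symmetric] by (rule Ex.IH) (simp add: Ex.prems that)
  show ?case
  proof
    assume "sat (ultrapower U A) v (Ex x \<phi>)"
    then obtain d where d: "d \<in> carrier (ultrapower U A)"
      and "sat (ultrapower U A) (v(x := d)) \<phi>" by auto
    then have "eventually (\<lambda>k. sat A ((\<lambda>i. v i k)(x := d k)) \<phi>) U" by (simp add: IH)
    then show "eventually (\<lambda>k. sat A (\<lambda>i. v i k) (Ex x \<phi>)) U"
      by eventually_elim (use ultrapower_carrier(1)[OF d] in auto)
  next
    assume ev: "eventually (\<lambda>k. sat A (\<lambda>i. v i k) (Ex x \<phi>)) U"
    have "\<exists>d. d \<in> carrier A \<and> (sat A (\<lambda>i. v i k) (Ex x \<phi>)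
        \<longrightarrow> sat A ((\<lambda>i. v i k)(x := d)) \<phi>)" for k
    proof (cases "sat A (\<lambda>i. v i k) (Ex x \<phi>)")
      \<comment> \<open>Any element serves as the value of the witness function where there is no witness.\<close>
      case False
      have "v 0 k \<in> carrier A" by (rule ultrapower_carrier(1)[OF Ex.prems])
      with False show ?thesis by blast
    qed auto
    then obtain f where f: "\<And>k. f k \<in> carrier A" and
      wit: "\<And>k. sat A (\<lambda>i. v i k) (Ex x \<phi>) \<Longrightarrow> sat A ((\<lambda>i. v i k)(x := f k)) \<phi>" by metis
    let ?d = "representative U A f"
    have "eventually (\<lambda>k. sat A ((\<lambda>i. v i k)(x := ?d k)) \<phi>) U"
      using ev representative(2)[of f A U, OF f] by eventually_elim (metis wit)
    then have "sat (ultrapower U A) (v(x := ?d)) \<phi>"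
      by (simp add: IH representative(3)[OF f])
    with representative(3)[OF f] show "sat (ultrapower U A) v (Ex x \<phi>)" by auto
  qed
qed

lemma is_struct_ultrapower:
  assumes "U \<noteq> bot" "is_struct \<sigma> A"
  shows "is_struct \<sigma> (ultrapower U A)"
  unfolding is_struct_def
proof (intro allI ballI conjI)
  fix R xs assume xs: "xs \<in> rel (ultrapower U A) R"
  then have "eventually (\<lambda>k. map (\<lambda>f. f k) xs \<in> rel A R) U" by (simp add: ultrapower_def)
  then obtain k where "map (\<lambda>f. f k) xs \<in> rel A R"
    using assms(1) eventually_happens by blast
  then show "\<sigma> R = Some (length xs)" using assms(2) by (fastforce simp: is_struct_def)
  show "set xs \<subseteq> carrier (ultrapower U A)" using xs by (simp add: ultrapower_def)
qed

section \<open>Countable categoricity\<close>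

text \<open>Categoricity speaks of structures on sets of natural numbers only; this makes it applicable to
  countable structures on any type.\<close>

lemma isomorphic_copy_on_nat:
  fixes X :: "('b, 'r) fo_struct"
  assumes "is_struct \<sigma> X" "countable (carrier X)"
  obtains Y :: "(nat, 'r) fo_struct" and f where "is_struct \<sigma> Y" "is_iso X Y f"
proof
  let ?f = "to_nat_on (carrier X)"
  define Y where "Y = \<lparr>carrier = ?f ` carrier X, rel = (\<lambda>R. map ?f ` rel X R)\<rparr>"
  have inj: "inj_on ?f (carrier X)" by (rule inj_on_to_nat_on[OF assms(2)])
  show "is_struct \<sigma> Y"
    unfolding is_struct_def
  proof (intro allI ballI)
    fix R ys assume "ys \<in> rel Y R"
    then obtain xs where xs: "xs \<in> rel X R" and ys: "ys = map ?f xs" by (auto simp: Y_def)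
    from xs assms(1) have "\<sigma> R = Some (length xs)" "set xs \<subseteq> carrier X" by (auto simp: is_struct_def)
    then show "\<sigma> R = Some (length ys) \<and> set ys \<subseteq> carrier Y" unfolding ys Y_def by auto
  qed
  show "is_iso X Y ?f"
    unfolding is_iso_def
  proof (intro conjI allI impI)
    show "bij_betw ?f (carrier X) (carrier Y)" using inj by (simp add: bij_betw_def Y_def)
    fix R xs assume xs: "set xs \<subseteq> carrier X"
    have "xs = ys" if "ys \<in> rel X R" "map ?f xs = map ?f ys" for ys
    proof (rule map_inj_on[OF that(2)])
      have "set xs \<union> set ys \<subseteq> carrier X" using xs that(1) assms(1) by (auto simp: is_struct_def)
      then show "inj_on ?f (set xs \<union> set ys)" by (rule inj_on_subset[OF inj])
    qed
    then show "xs \<in> rel X R \<longleftrightarrow> map ?f xs \<in> rel Y R" by (auto simp: Y_def)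
  qed
qed

locale categorical_structure =
  fixes \<sigma> :: "'r signature" and A :: "('a, 'r) fo_struct"
  assumes countable_signature: "countable (dom \<sigma>)"
    and is_structure: "is_struct \<sigma> A"
    and countable_carrier: "countable (carrier A)"
    and nonempty: "carrier A \<noteq> {}"
    and homogeneous: "homogeneous A"
    and categorical: "omega_categorical \<sigma> A"
begin

lemma countable_model_unique:
  fixes X :: "('b, 'r) fo_struct"
  assumes X: "is_struct \<sigma> X" "countable (carrier X)" "carrier X \<noteq> {}"
    and T: "\<And>\<phi>. \<phi> \<in> theory_of \<sigma> A \<Longrightarrow> holds X \<phi> []"
  obtains f where "is_iso A X f"
proof -
  obtain M :: "(nat, 'r) fo_struct" where
    M: "\<And>N :: (nat, 'r) fo_struct. N \<in> models \<sigma> (theory_of \<sigma> A) \<Longrightarrow> isomorphisms N M \<noteq> {}"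
    using categorical by (auto simp: omega_categorical_def)
  have iso: "\<exists>h. is_iso Y M h"
    if Y: "is_struct \<sigma> Y" "countable (carrier Y)" "carrier Y \<noteq> {}"
      and TY: "\<And>\<phi>. \<phi> \<in> theory_of \<sigma> A \<Longrightarrow> holds Y \<phi> []" for Y :: "('c, 'r) fo_struct"
  proof -
    obtain N :: "(nat, 'r) fo_struct" and f where N: "is_struct \<sigma> N" "is_iso Y N f"
      using isomorphic_copy_on_nat[OF Y(1,2)] .
    have "holds N \<phi> []" if "\<phi> \<in> theory_of \<sigma> A" for \<phi>
      using is_iso_holds[OF N(2), of "[]" \<phi> \<sigma>] TY[OF that] Y(3) that by (simp add: theory_of_def)
    with N(1) have "N \<in> models \<sigma> (theory_of \<sigma> A)" by (simp add: models_def)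
    from M[OF this] obtain g where "is_iso N M g" using isomorphisms_is_iso by blast
    with is_iso_comp[OF N(2)] show ?thesis by blast
  qed
  obtain f where f: "is_iso X M f" using iso[OF X T] by blast
  obtain g where g: "is_iso A M g"
    using iso[OF is_structure countable_carrier nonempty] by (auto simp: theory_of_def)
  show thesis using that[OF is_iso_comp[OF g is_iso_inv[OF f]]] .
qed

text \<open>The coordinates of the tuples \<open>t k\<close>, taken as functions of \<open>k\<close>, form a tuple of the ultrapower
  that satisfies exactly the formulas true of \<open>t k\<close> for \<open>U\<close>-almost all \<open>k\<close>, in particular for
  infinitely many \<open>k\<close>, where \<open>U\<close> is a nonprincipal ultrafilter.  It lies in a
  countable elementary substructure of the ultrapower, and this is isomorphic to \<open>A\<close>.\<close>

lemma accumulation_tuple: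
  fixes t :: "nat \<Rightarrow> 'a list"
  assumes t: "\<And>k. length (t k) = n" "\<And>k. set (t k) \<subseteq> carrier A"
  obtains s where "length s = n" "set s \<subseteq> carrier A"
    "\<forall>\<phi> \<in> formulas \<sigma> n. holds A \<phi> s \<longrightarrow> infinite {k. holds A \<phi> (t k)}"
proof -
  obtain U :: "nat filter" where U: "U \<noteq> bot" "U \<le> sequentially"
    "\<And>P. eventually P U \<or> eventually (\<lambda>k. \<not> P k) U" using ultrafilter_exists by blast
  obtain c where c: "c \<in> carrier A" using nonempty by blast
  define N where "N = ultrapower U A"
  define e where "e = (\<lambda>i. representative U A (\<lambda>k. pad c (t k) i))"
  have pad: "pad c (t k) i \<in> carrier A" for k i
    using t(1)[of k] subsetD[OF t(2)[of k] nth_mem] c by (simp add: pad_def)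
  have e: "e i \<in> carrier N" for i unfolding e_def N_def by (rule representative(3)) (rule pad)
  obtain B where B: "range e \<subseteq> B" "B \<subseteq> carrier N" "countable B" and
    elem: "\<And>\<phi> v. wf_fm \<sigma> \<phi> \<Longrightarrow> (\<And>i. v i \<in> B) \<Longrightarrow> sat (restrict_struct N B) v \<phi> \<longleftrightarrow> sat N v \<phi>"
    using downward_loewenheim_skolem[OF countable_signature, of "range e" N] e by auto
  let ?X = "restrict_struct N B"
  have eB: "e i \<in> B" for i using B by auto
  have sat: "sat ?X e \<phi> \<longleftrightarrow> eventually (\<lambda>k. holds A \<phi> (t k)) U" if "\<phi> \<in> formulas \<sigma> n" for \<phi>
  proof -
    have "sat ?X e \<phi> \<longleftrightarrow> eventually (\<lambda>k. sat A (\<lambda>i. e i k) \<phi>) U"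
      using elem[of \<phi> e] eB that los[OF U(1,3), where v = e and A = A] e
      by (simp add: formulas_def N_def)
    also have "\<dots> \<longleftrightarrow> eventually (\<lambda>k. holds A \<phi> (t k)) U"
    proof (rule eventually_subst)
      have "eventually (\<lambda>k. \<forall>i \<in> {..<n}. e i k = pad c (t k) i) U"
        unfolding e_def by (intro eventually_ball_finite) (auto intro!: representative(2) pad)
      then show "eventually (\<lambda>k. sat A (\<lambda>i. e i k) \<phi> \<longleftrightarrow> holds A \<phi> (t k)) U"
        by eventually_elim (intro holds_cong[OF that], auto simp: pad_def t)
    qed
    finally show ?thesis .
  qed
  obtain f where f: "is_iso A ?X f"
  proof (rule countable_model_unique)
    show "is_struct \<sigma> ?X"
      unfolding N_def by (intro is_struct_restrict is_struct_ultrapower U(1) is_structure)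
    show "countable (carrier ?X)" "carrier ?X \<noteq> {}"
      using B by (auto simp: restrict_struct_def)
    fix \<phi> assume \<phi>: "\<phi> \<in> theory_of \<sigma> A"
    then have *: "\<phi> \<in> formulas \<sigma> 0" "holds A \<phi> []" by (auto simp: theory_of_def)
    then have "\<phi> \<in> formulas \<sigma> n" by (auto simp: formulas_def)
    moreover have "holds A \<phi> (t k)" for k
      using * holds_cong[OF *(1)] by blast
    ultimately have "sat ?X e \<phi>" using sat by simp
    then show "holds ?X \<phi> []" using holds_cong[OF *(1)] by blast
  qed
  then have g: "is_iso ?X A (inv_into (carrier A) f)" (is "is_iso ?X A ?g") by (rule is_iso_inv)
  have ecar: "e i \<in> carrier ?X" for i using eB by (simp add: restrict_struct_def)
  show thesis
  proof
    show "length (map (?g \<circ> e) [0..<n]) = n" by simp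
    show "set (map (?g \<circ> e) [0..<n]) \<subseteq> carrier A"
      using is_iso_in[OF g ecar] by auto
    show "\<forall>\<phi> \<in> formulas \<sigma> n. holds A \<phi> (map (?g \<circ> e) [0..<n])
        \<longrightarrow> infinite {k. holds A \<phi> (t k)}"
    proof (intro ballI impI)
      fix \<phi> assume \<phi>: "\<phi> \<in> formulas \<sigma> n" and h: "holds A \<phi> (map (?g \<circ> e) [0..<n])"
      have "holds A \<phi> (map (?g \<circ> e) [0..<n]) \<longleftrightarrow> sat A (?g \<circ> e) \<phi>"
        by (rule holds_cong[OF \<phi>]) simp
      with h is_iso_sat[OF g, of e \<phi>] ecar sat[OF \<phi>]
      have ev: "eventually (\<lambda>k. holds A \<phi> (t k)) U" by simp
      show "infinite {k. holds A \<phi> (t k)}"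
      proof (rule notI)
        assume "finite {k. holds A \<phi> (t k)}"
        then have "eventually (\<lambda>k. \<not> holds A \<phi> (t k)) cofinite" by (simp add: eventually_cofinite)
        then have "eventually (\<lambda>k. \<not> holds A \<phi> (t k)) U"
          using U(2) by (simp add: cofinite_eq_sequentially filter_leD)
        with ev have "eventually (\<lambda>_. False) U" by eventually_elim simp
        with U(1) show False by (simp add: trivial_limit_def)
      qed
    qed
  qed
qed

section \<open>Orbits and types\<close>

definition orb :: "'a list \<Rightarrow> 'a list \<Rightarrow> bool" where
  "orb a b \<longleftrightarrow> (\<exists>g. is_iso A A g \<and> map g a = b)"

lemma orbI: "is_iso A A g \<Longrightarrow> orb a (map g a)"
  by (auto simp: orb_def)

lemma orb_length: "orb a b \<Longrightarrow> length b = length a"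
  by (auto simp: orb_def)

lemma orb_carrier: "orb a b \<Longrightarrow> set a \<subseteq> carrier A \<Longrightarrow> set b \<subseteq> carrier A"
  unfolding orb_def is_iso_def bij_betw_def by (metis image_mono list.set_map)

lemma orb_trans: "orb a b \<Longrightarrow> orb b c \<Longrightarrow> orb a c"
  unfolding orb_def by (metis is_iso_comp list.map_comp)

lemma map_inverse:
  assumes "is_iso A A g" "set a \<subseteq> carrier A"
  shows "map (inv_into (carrier A) g) (map g a) = a"
  using assms by (auto simp: map_idI is_iso_def bij_betw_inv_into_left subset_eq)

lemma orb_sym: "orb a b \<Longrightarrow> set a \<subseteq> carrier A \<Longrightarrow> orb b a"
  unfolding orb_def using is_iso_inv map_inverse by blast

lemma orb_map: "is_iso A A g \<Longrightarrow> set a \<subseteq> carrier A \<Longrightarrow> orb (map g a) a"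
  by (rule orb_sym[OF orbI])

lemma orb_type: "orb a b \<Longrightarrow> set a \<subseteq> carrier A \<Longrightarrow> type_of \<sigma> A b = type_of \<sigma> A a"
  unfolding orb_def using type_of_is_iso[OF _ _ nonempty] by blast

lemma orb_holds:
  "orb a b \<Longrightarrow> set a \<subseteq> carrier A \<Longrightarrow> \<phi> \<in> formulas \<sigma> (length a) \<Longrightarrow> holds A \<phi> b \<longleftrightarrow> holds A \<phi> a"
  unfolding orb_def using is_iso_holds[OF _ _ _ nonempty] by blast

text \<open>Homogeneity for maps that are given on a finite set and preserve relations there.\<close>

lemma extend_partial_iso:
  assumes S: "finite S" "S \<subseteq> carrier A" and f: "inj_on f S" "f ` S \<subseteq> carrier A"
    and rel: "\<And>R xs. set xs \<subseteq> S \<Longrightarrow> xs \<in> rel A R \<longleftrightarrow> map f xs \<in> rel A R"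
  obtains g where "is_iso A A g" "\<And>x. x \<in> S \<Longrightarrow> g x = f x"
proof -
  let ?B = "restrict_struct A S" and ?C = "restrict_struct A (f ` S)"
  have "xs \<in> rel ?B R \<longleftrightarrow> map (restrict f S) xs \<in> rel ?C R" if xs: "set xs \<subseteq> S" for R xs
  proof -
    have "map (restrict f S) xs = map f xs" using xs by auto
    moreover have "xs \<in> rel ?B R \<longleftrightarrow> map f xs \<in> rel ?C R"
      using xs rel[OF xs] by (auto simp: restrict_struct_def)
    ultimately show ?thesis by (simp only:)
  qed
  moreover have "restrict f S ` S = f ` S" "inj_on (restrict f S) S" using f by auto
  ultimately have "restrict f S \<in> isomorphisms ?B ?C"
    by (simp add: isomorphisms_def embeddings_def restrict_struct_def)
  moreover have "substructure ?B A" "substructure ?C A"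
    using S f by (auto intro: substructure_restrict)
  moreover have "finite (carrier ?B)" "finite (carrier ?C)" "carrier ?B = S"
    using S by (auto simp: restrict_struct_def)
  ultimately obtain g where "g \<in> isomorphisms A A" "\<forall>x \<in> S. g x = restrict f S x"
    using homogeneous unfolding homogeneous_def by metis
  with that show thesis by (auto dest: isomorphisms_is_iso)
qed

text \<open>Equal atomic types already make \<open>a ! i \<mapsto> b ! i\<close> a well-defined isomorphism of finite
  substructures, which homogeneity extends to an automorphism.\<close>

lemma type_eq_orb:
  assumes a: "set a \<subseteq> carrier A" and b: "set b \<subseteq> carrier A" and len: "length b = length a"
    and type: "type_of \<sigma> A a = type_of \<sigma> A b"
  shows "orb a b"
proof -
  have iff: "holds A \<phi> a \<longleftrightarrow> holds A \<phi> b" if "\<phi> \<in> formulas \<sigma> (length a)" for \<phi>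
    using type that len by (auto simp: type_of_def)
  have eq: "a ! i = a ! j \<longleftrightarrow> b ! i = b ! j" if "i < length a" "j < length a" for i j
    using iff[of "Eq i j"] that by (auto simp: formulas_def)
  define f where "f x = b ! (SOME i. i < length a \<and> a ! i = x)" for x
  have f: "f (a ! i) = b ! i" if "i < length a" for i
  proof -
    let ?j = "SOME j. j < length a \<and> a ! j = a ! i"
    have "?j < length a \<and> a ! ?j = a ! i" by (rule someI[of _ i]) (use that in simp)
    then show ?thesis unfolding f_def using eq that by blast
  qed
  have "xs \<in> rel A R \<longleftrightarrow> map f xs \<in> rel A R" if xs: "set xs \<subseteq> set a" for R xs
  proof (cases "\<sigma> R = Some (length xs)")
    case True
    have "\<forall>x \<in> set xs. \<exists>i. i < length a \<and> a ! i = x" using xs by (auto simp: in_set_conv_nth)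
    then obtain k where k: "\<And>x. x \<in> set xs \<Longrightarrow> k x < length a \<and> a ! k x = x" by metis
    have "map ((!) a) (map k xs) = xs" "map ((!) b) (map k xs) = map f xs"
      using k f by (auto simp: map_idI) metis
    then show ?thesis
      using iff[of "Rel R (map k xs)"] True k by (auto simp: formulas_def simp del: map_map)
  next
    case False
    then show ?thesis using is_structure by (auto simp: is_struct_def)
  qed
  moreover have "inj_on f (set a)"
    using f eq by (auto simp: inj_on_def in_set_conv_nth)
  moreover have "f ` set a = set b"
    using f len by (auto simp: set_conv_nth image_iff) metis
  ultimately obtain g where g: "is_iso A A g" "\<And>x. x \<in> set a \<Longrightarrow> g x = f x"
    using extend_partial_iso[of "set a" f, OF finite_set a] b by metis
  have "map g a = b" using g(2) f len by (auto intro: nth_equalityI)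
  with g(1) show ?thesis by (auto simp: orb_def)
qed

lemma separating_formula:
  assumes "set a \<subseteq> carrier A" "set b \<subseteq> carrier A" "length b = length a" "\<not> orb a b"
  obtains \<phi> where "\<phi> \<in> formulas \<sigma> (length a)" "holds A \<phi> a" "\<not> holds A \<phi> b"
proof -
  obtain \<phi> where \<phi>: "\<phi> \<in> formulas \<sigma> (length a)" "holds A \<phi> a \<noteq> holds A \<phi> b"
    using type_eq_orb[OF assms(1-3)] assms(3,4) by (auto simp: type_of_def)
  then have "Neg \<phi> \<in> formulas \<sigma> (length a)" by (simp add: formulas_def)
  with \<phi> that[of \<phi>] that[of "Neg \<phi>"] show thesis by auto
qed

section \<open>Isolated types\<close>

text \<open>The type of \<open>a\<close> is isolated by \<open>\<theta>\<close>; that \<open>\<theta>\<close> implies the type is expressed by orbits.\<close>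

definition isolated :: "'a list \<Rightarrow> bool" where
  "isolated a \<longleftrightarrow> (\<exists>\<theta> \<in> formulas \<sigma> (length a). holds A \<theta> a \<and>
     (\<forall>b. length b = length a \<and> set b \<subseteq> carrier A \<and> holds A \<theta> b \<longrightarrow> orb a b))"

lemma isolated_orb:
  assumes "isolated a" "orb a b" "set a \<subseteq> carrier A"
  shows "isolated b"
  using assms orb_holds[OF assms(2,3)] orb_trans[OF orb_sym[OF assms(2,3)]] orb_length[OF assms(2)]
  unfolding isolated_def by metis

text \<open>Suppose that \<open>\<phi>\<close> is in no isolated type.  Then every satisfiable strengthening of \<open>\<phi>\<close> is
  satisfied by two tuples of different orbits, so it can be strengthened again so as to exclude
  any one given tuple.  Going through an enumeration of all tuples in this way gives a
  decreasing sequence of satisfiable formulas with no common solution in \<open>A\<close>, whereas solutions of the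
  individual formulas accumulate at a common one.\<close>

lemma isolated_dense:
  assumes \<phi>: "\<phi> \<in> formulas \<sigma> n" and a: "length a = n" "set a \<subseteq> carrier A" "holds A \<phi> a"
  obtains b where "length b = n" "set b \<subseteq> carrier A" "holds A \<phi> b" "isolated b"
proof (rule ccontr)
  assume "\<not> thesis"
  with that have none: "\<not> isolated b"
    if "length b = n" "set b \<subseteq> carrier A" "holds A \<phi> b" for b using that by blast
  define T where "T = {b. length b = n \<and> set b \<subseteq> carrier A}"
  have "T \<subseteq> lists (carrier A)" by (auto simp: T_def)
  then have "countable T" using countable_carrier by (meson countable_lists countable_subset)
  moreover have "T \<noteq> {}" using a by (auto simp: T_def)
  ultimately have T: "range (from_nat_into T) = T" by (simp add: range_from_nat_into)
  define P where "P = (\<lambda>(k::nat) \<psi>. \<psi> \<in> formulas \<sigma> n \<and> (\<exists>b \<in> T. holds A \<psi> b) \<and>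
                           (\<forall>b \<in> T. holds A \<psi> b \<longrightarrow> holds A \<phi> b))"
  define Q where "Q = (\<lambda>k \<psi> \<psi>'. (\<forall>b \<in> T. holds A \<psi>' b \<longrightarrow> holds A \<psi> b) \<and>
                           \<not> holds A \<psi>' (from_nat_into T k))"
  have "\<exists>\<Psi>. \<forall>k. P k (\<Psi> k) \<and> Q k (\<Psi> k) (\<Psi> (Suc k))"
  proof (rule dependent_nat_choice)
    show "\<exists>\<psi>. P 0 \<psi>" using \<phi> a by (auto simp: P_def T_def)
    fix \<psi> k assume P: "P k \<psi>"
    let ?e = "from_nat_into T k"
    have e: "?e \<in> T" using T by blast
    show "\<exists>\<psi>'. P (Suc k) \<psi>' \<and> Q k \<psi> \<psi>'"
    proof (cases "holds A \<psi> ?e")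
      case True
      with P none e have "\<not> isolated ?e" by (auto simp: P_def T_def)
      with True P e obtain b where b: "b \<in> T" "holds A \<psi> b" "\<not> orb ?e b"
        unfolding isolated_def P_def T_def by force
      obtain \<chi> where \<chi>: "\<chi> \<in> formulas \<sigma> n" "holds A \<chi> ?e" "\<not> holds A \<chi> b"
        using separating_formula[of ?e b] e b by (auto simp: T_def)
      have "P (Suc k) (Conj \<psi> (Neg \<chi>))" "Q k \<psi> (Conj \<psi> (Neg \<chi>))"
        using P b \<chi> by (auto simp: P_def Q_def formulas_def)
      then show ?thesis by blast
    next
      case False
      with P show ?thesis by (auto simp: P_def Q_def)
    qed
  qed
  then obtain \<Psi> where P: "\<And>k. P k (\<Psi> k)" and Q: "\<And>k. Q k (\<Psi> k) (\<Psi> (Suc k))" by blast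
  have dec: "holds A (\<Psi> j) b" if "j \<le> k" "b \<in> T" "holds A (\<Psi> k) b" for j k b
    using that
  proof (induction k rule: dec_induct)
    case (step k)
    from Q[of k] step show ?case unfolding Q_def by blast
  qed
  have "\<exists>b. b \<in> T \<and> holds A (\<Psi> k) b" for k using P[of k] by (auto simp: P_def)
  then obtain t where t: "\<And>k. t k \<in> T" "\<And>k. holds A (\<Psi> k) (t k)" by metis
  have "length (t k) = n" "set (t k) \<subseteq> carrier A" for k using t(1)[of k] by (auto simp: T_def)
  then obtain s where s_tuple: "length s = n" "set s \<subseteq> carrier A" and
    acc: "\<forall>\<psi> \<in> formulas \<sigma> n. holds A \<psi> s \<longrightarrow> infinite {k. holds A \<psi> (t k)}"
    using accumulation_tuple[of t n] by blast
  from s_tuple have s: "s \<in> T" by (simp add: T_def)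
  have "holds A (\<Psi> j) s" for j
  proof (rule ccontr)
    assume "\<not> holds A (\<Psi> j) s"
    then have "infinite {k. holds A (Neg (\<Psi> j)) (t k)}"
      using bspec[OF acc, of "Neg (\<Psi> j)"] P[of j] by (auto simp: P_def formulas_def)
    moreover have "{k. holds A (Neg (\<Psi> j)) (t k)} \<subseteq> {..<j}"
      using dec[OF _ t(1) t(2)] by (auto simp: not_le[symmetric])
    ultimately show False using finite_subset by blast
  qed
  moreover obtain j where "s = from_nat_into T j" using s T by blast
  ultimately show False using Q[of j] by (auto simp: Q_def)
qed

lemma formulas_mono: "m \<le> n \<Longrightarrow> formulas \<sigma> m \<subseteq> formulas \<sigma> n"
  by (auto simp: formulas_def)

lemma holds_append: "\<phi> \<in> formulas \<sigma> (length a) \<Longrightarrow> holds A \<phi> (a @ b) \<longleftrightarrow> holds A \<phi> a"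
  by (rule holds_cong) (auto simp: nth_append)

text \<open>An isolating formula of \<open>b\<close> together with \<open>\<phi>\<close> belongs to an isolated type; a tuple of this type
  starts with a tuple in the orbit of \<open>b\<close>, and an automorphism moves it to an extension of \<open>b\<close>.
  The new point is put in front of \<open>b\<close> in \<open>\<phi>\<close>, as variable \<open>0\<close>, so that the variable of the witness
  does not depend on the length of \<open>b\<close>; in the isolated tuple it is put at the end, so
  that the tuples that are built one point after the other are initial segments of each other.\<close>

lemma isolated_witness:
  assumes b: "isolated b" "set b \<subseteq> carrier A" and \<phi>: "\<phi> \<in> formulas \<sigma> (Suc (length b))"
    and d: "d \<in> carrier A" "holds A \<phi> (d # b)"
  obtains d' where "d' \<in> carrier A" "holds A \<phi> (d' # b)" "isolated (b @ [d'])"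
proof -
  let ?k = "length b"
  define \<phi>' where "\<phi>' = subst_fm (\<lambda>i. if i = 0 then ?k else i - 1) \<phi>"
  have "fv \<phi>' \<subseteq> {..<Suc ?k}"
    using fv_subst_fm[of "\<lambda>i. if i = 0 then ?k else i - 1" \<phi>] \<phi>
    unfolding \<phi>'_def formulas_def by fastforce
  then have \<phi>': "\<phi>' \<in> formulas \<sigma> (Suc ?k)" using \<phi> by (simp add: formulas_def \<phi>'_def)
  have rot: "holds A \<phi>' (c @ [e]) \<longleftrightarrow> holds A \<phi> (e # c)" if "length c = ?k" for c e
    unfolding \<phi>'_def sat_subst_fm using that
    by (intro holds_cong[OF \<phi>]) (auto simp: nth_append nth_Cons' )
  obtain \<theta> where \<theta>: "\<theta> \<in> formulas \<sigma> ?k" "holds A \<theta> b"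
    and iso: "\<And>c. length c = ?k \<Longrightarrow> set c \<subseteq> carrier A \<Longrightarrow> holds A \<theta> c \<Longrightarrow> orb b c"
    using b by (auto simp: isolated_def)
  have "Conj \<theta> \<phi>' \<in> formulas \<sigma> (Suc ?k)"
    using \<theta>(1) \<phi>' formulas_mono[of ?k "Suc ?k"] by (auto simp: formulas_def)
  moreover have "holds A (Conj \<theta> \<phi>') (b @ [d])"
    using \<theta> d rot[of b d] holds_append[of \<theta> b "[d]"] by simp
  ultimately obtain l where l: "length l = Suc ?k" "set l \<subseteq> carrier A" "holds A (Conj \<theta> \<phi>') l"
      "isolated l"
    using isolated_dense[of "Conj \<theta> \<phi>'" "Suc ?k" "b @ [d]"] b d by auto
  then obtain c e where ce: "l = c @ [e]" by (metis length_0_conv nat.simps(3) rev_exhaust)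
  with l have c: "length c = ?k" "set c \<subseteq> carrier A" "e \<in> carrier A" by auto
  have "holds A \<theta> c" "holds A \<phi> (e # c)"
    using l(3) ce rot[of c e] holds_append[of \<theta> c "[e]"] \<theta>(1) c by auto
  from orb_sym[OF iso[OF c(1,2) this(1)] b(2)] obtain g where g: "is_iso A A g" "map g c = b"
    by (auto simp: orb_def)
  show thesis
  proof
    show "g e \<in> carrier A" using is_iso_in[OF g(1) c(3)] .
    show "holds A \<phi> (g e # b)"
      using orb_holds[OF orbI[OF g(1)], of "e # c" \<phi>] \<phi> c g(2) \<open>holds A \<phi> (e # c)\<close> by simp
    show "isolated (b @ [g e])"
      using isolated_orb[OF l(4) orbI[OF g(1)] l(2)] ce g(2) by simp
  qed
qed

text \<open>If \<open>\<theta>\<close> isolates \<open>a @ [d]\<close>, then \<open>\<exists>y. \<theta>\<close> isolates \<open>a\<close>.\<close>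

lemma isolated_butlast:
  assumes "isolated (a @ [d])" "set a \<subseteq> carrier A" "d \<in> carrier A"
  shows "isolated a"
proof -
  let ?n = "length a"
  obtain \<theta> where \<theta>: "\<theta> \<in> formulas \<sigma> (Suc ?n)" "holds A \<theta> (a @ [d])"
    and iso: "\<And>c. length c = Suc ?n \<Longrightarrow> set c \<subseteq> carrier A \<Longrightarrow> holds A \<theta> c \<Longrightarrow> orb (a @ [d]) c"
    using assms(1) by (auto simp: isolated_def)
  have upd: "sat A (((!) c)(?n := e)) \<theta> \<longleftrightarrow> holds A \<theta> (c @ [e])" if "length c = ?n" for c e
    using that by (intro holds_cong[OF \<theta>(1)]) (auto simp: nth_append less_Suc_eq)
  have "Ex ?n \<theta> \<in> formulas \<sigma> ?n" using \<theta>(1) by (auto simp: formulas_def less_Suc_eq)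
  moreover have "holds A (Ex ?n \<theta>) a" using \<theta>(2) upd[of a d] assms(3) by auto
  moreover have "orb a c" if c: "length c = ?n" "set c \<subseteq> carrier A" "holds A (Ex ?n \<theta>) c" for c
  proof -
    obtain e where e: "e \<in> carrier A" "holds A \<theta> (c @ [e])"
      using c upd[of c] by auto
    then have "orb (a @ [d]) (c @ [e])" using c by (intro iso) auto
    then show ?thesis using c(1) by (auto simp: orb_def)
  qed
  ultimately show ?thesis unfolding isolated_def by blast
qed

lemma isolated_append_member:
  assumes "isolated a" "x \<in> set a"
  shows "isolated (a @ [x])"
proof -
  let ?n = "length a"
  obtain \<theta> where \<theta>: "\<theta> \<in> formulas \<sigma> ?n" "holds A \<theta> a"
    and iso: "\<And>c. length c = ?n \<Longrightarrow> set c \<subseteq> carrier A \<Longrightarrow> holds A \<theta> c \<Longrightarrow> orb a c"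
    using assms(1) by (auto simp: isolated_def)
  obtain i where i: "i < ?n" "a ! i = x" using assms(2) by (auto simp: in_set_conv_nth)
  have "Conj \<theta> (Eq i ?n) \<in> formulas \<sigma> (length (a @ [x]))"
    using \<theta>(1) i(1) by (auto simp: formulas_def)
  moreover have "holds A (Conj \<theta> (Eq i ?n)) (a @ [x])"
    using \<theta> i holds_append[OF \<theta>(1), of "[x]"] by (simp add: nth_append)
  moreover have "orb (a @ [x]) l"
    if l: "length l = length (a @ [x])" "set l \<subseteq> carrier A" "holds A (Conj \<theta> (Eq i ?n)) l" for l
  proof -
    obtain c e where ce: "l = c @ [e]" using l(1) by (cases l rule: rev_cases) auto
    with l have c: "length c = ?n" "set c \<subseteq> carrier A" by auto
    have "holds A \<theta> c" "c ! i = e"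
      using l(3) ce c i holds_append[of \<theta> c "[e]"] \<theta>(1) by (auto simp: nth_append)
    from iso[OF c this(1)] obtain g where g: "is_iso A A g" "map g a = c" by (auto simp: orb_def)
    then have "map g (a @ [x]) = l" using i ce \<open>c ! i = e\<close> by auto
    with g(1) show ?thesis by (auto simp: orb_def)
  qed
  ultimately show ?thesis unfolding isolated_def by blast
qed

lemma isolated_rotate:
  assumes "isolated (a @ b)"
  shows "isolated (b @ a)"
proof -
  let ?m = "length a" and ?n = "length b"
  obtain \<theta> where \<theta>: "\<theta> \<in> formulas \<sigma> (?m + ?n)" "holds A \<theta> (a @ b)"
    and iso: "\<And>c. length c = ?m + ?n \<Longrightarrow> set c \<subseteq> carrier A \<Longrightarrow> holds A \<theta> c \<Longrightarrow> orb (a @ b) c"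
    using assms(1) by (auto simp: isolated_def)
  define p where "p = (\<lambda>i. if i < ?m then ?n + i else i - ?m)"
  have "fv (subst_fm p \<theta>) \<subseteq> {..<?n + ?m}"
    using fv_subst_fm[of p \<theta>] \<theta>(1) by (fastforce simp: formulas_def p_def)
  then have "subst_fm p \<theta> \<in> formulas \<sigma> (length (b @ a))" using \<theta>(1) by (simp add: formulas_def)
  moreover have rot: "holds A (subst_fm p \<theta>) (d @ c) \<longleftrightarrow> holds A \<theta> (c @ d)"
    if "length c = ?m" "length d = ?n" for c d
    unfolding sat_subst_fm using that by (intro holds_cong[OF \<theta>(1)]) (auto simp: nth_append p_def)
  moreover have "holds A (subst_fm p \<theta>) (b @ a)" using rot \<theta>(2) by simp
  moreover have "orb (b @ a) l"
    if l: "length l = length (b @ a)" "set l \<subseteq> carrier A" "holds A (subst_fm p \<theta>) l" for l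
  proof -
    define d c where "d = take ?n l" and "c = drop ?n l"
    then have dc: "l = d @ c" "length d = ?n" "length c = ?m" using l(1) by auto
    then have "holds A \<theta> (c @ d)" using l(3) rot by simp
    then have "orb (a @ b) (c @ d)" using dc l(2) by (intro iso) auto
    then obtain g where "is_iso A A g" "map g a = c" "map g b = d"
      using dc by (auto simp: orb_def append_eq_append_conv)
    then show ?thesis using dc(1) by (auto simp: orb_def)
  qed
  ultimately show ?thesis unfolding isolated_def by blast
qed

text \<open>First append \<open>c\<close> to \<open>a\<close>, then remove \<open>a\<close> from behind \<open>c\<close>.\<close>

lemma isolated_sublist:
  assumes "isolated a" "set a \<subseteq> carrier A" "set c \<subseteq> set a"
  shows "isolated c"
proof -
  have "set c \<subseteq> set a \<Longrightarrow> isolated (a @ c)"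
  proof (induction c rule: rev_induct)
    case (snoc x c)
    then show ?case using isolated_append_member[of "a @ c" x] by auto
  qed (simp add: assms(1))
  then have "isolated (c @ a)" using isolated_rotate assms(3) by blast
  then show ?thesis using assms(2)
  proof (induction a rule: rev_induct)
    case (snoc x a)
    have "set (c @ a) \<subseteq> carrier A" using snoc.prems(2) assms by auto
    then show ?case using snoc isolated_butlast[of "c @ a" x] by auto
  qed simp
qed

end

section \<open>Finitely many types\<close>

lemma finite_subset_range:
  fixes b :: "nat \<Rightarrow> 'b"
  assumes "finite S" "S \<subseteq> range b"
  obtains k where "S \<subseteq> b ` {..<k}"
proof -
  obtain J where "finite J" "S = b ` J" using finite_subset_image[OF assms] by blast
  moreover obtain k where "J \<subseteq> {..<k}" using finite_nat_bounded[OF \<open>finite J\<close>] by blast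
  ultimately show thesis using that by blast
qed

context categorical_structure
begin

lemma isolated_Nil: "isolated []"
proof -
  have "Ex 0 (Eq 0 0) \<in> formulas \<sigma> (length ([] :: 'a list))" by (simp add: formulas_def)
  moreover have "holds A (Ex 0 (Eq 0 0)) []" using nonempty by auto
  moreover have "orb [] []" using orbI[OF is_iso_id, of "[]"] by simp
  ultimately show ?thesis unfolding isolated_def by (intro bexI conjI allI impI) auto
qed

text \<open>Add one point after the other, keeping initial segments isolated.  At stage
  \<open>prod_encode (j, m)\<close> the point is chosen as a witness for the \<open>j\<close>-th formula, with the
  points found so far as parameters, if there is such a witness in \<open>A\<close>.  As \<open>m\<close>
  is arbitrary, every formula is treated after its parameters have appeared, and the criterion of
  Tarski and Vaught is satisfied.\<close>

lemma atomic_elementary_sequence: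
  obtains b :: "nat \<Rightarrow> 'a" where "range b \<subseteq> carrier A" "\<And>k. isolated (map b [0..<k])"
    "\<And>\<phi> v. wf_fm \<sigma> \<phi> \<Longrightarrow> (\<And>i. v i \<in> range b)
      \<Longrightarrow> sat (restrict_struct A (range b)) v \<phi> \<longleftrightarrow> sat A v \<phi>"
proof -
  let ?W = "{\<phi>. wf_fm \<sigma> \<phi>}"
  define \<Phi> where "\<Phi> k = from_nat_into ?W (fst (prod_decode k))" for k
  have "Eq 0 0 \<in> ?W" by simp
  then have W: "range (from_nat_into ?W) = ?W"
    using countable_wf_fm[OF countable_signature] by (intro range_from_nat_into) blast+
  define P where "P = (\<lambda>k l. length l = k \<and> set l \<subseteq> carrier A \<and> isolated l)"
  define Q where "Q = (\<lambda>k l l'. \<exists>d. l' = l @ [d] \<and>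
      (\<Phi> k \<in> formulas \<sigma> (Suc k) \<and> (\<exists>d \<in> carrier A. holds A (\<Phi> k) (d # l))
        \<longrightarrow> holds A (\<Phi> k) (d # l)))"
  have "\<exists>F. \<forall>k. P k (F k) \<and> Q k (F k) (F (Suc k))"
  proof (rule dependent_nat_choice)
    show "\<exists>l. P 0 l" using isolated_Nil by (auto simp: P_def)
    fix l k assume P: "P k l"
    show "\<exists>l'. P (Suc k) l' \<and> Q k l l'"
    proof (cases "\<Phi> k \<in> formulas \<sigma> (Suc k) \<and> (\<exists>d \<in> carrier A. holds A (\<Phi> k) (d # l))")
      case True
      with P obtain d where "d \<in> carrier A" "holds A (\<Phi> k) (d # l)" "isolated (l @ [d])"
        using isolated_witness[of l "\<Phi> k"] by (auto simp: P_def)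
      with P have "P (Suc k) (l @ [d])" "Q k l (l @ [d])" by (auto simp: P_def Q_def)
      then show ?thesis by blast
    next
      case False
      have "Eq 0 0 \<in> formulas \<sigma> (Suc (length l))" by (simp add: formulas_def)
      with P nonempty obtain d where "d \<in> carrier A" "isolated (l @ [d])"
        using isolated_witness[of l "Eq 0 0"] by (auto simp: P_def)
      with P False have "P (Suc k) (l @ [d])" "Q k l (l @ [d])" by (auto simp: P_def Q_def)
      then show ?thesis by blast
    qed
  qed
  then obtain F where P: "\<And>k. P k (F k)" and Q: "\<And>k. Q k (F k) (F (Suc k))" by blast
  define b where "b k = F (Suc k) ! k" for k
  have step: "F (Suc k) = F k @ [b k]" for k
    using P[of k] Q[of k] by (auto simp: P_def Q_def b_def nth_append)
  have F: "F k = map b [0..<k]" for k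
  proof (induction k)
    case 0
    show ?case using P[of 0] by (simp add: P_def)
  qed (simp add: step)
  have b_in: "b k \<in> carrier A" for k
    using P[of "Suc k"] step[of k] by (simp add: P_def)
  have witness: "\<exists>d \<in> range b. sat A (v(x := d)) \<phi>"
    if \<phi>: "wf_fm \<sigma> \<phi>" and v: "\<And>i. v i \<in> range b" and ex: "\<exists>d \<in> carrier A. sat A (v(x := d)) \<phi>"
    for \<phi> x v
  proof -
    have "\<exists>j. v i = b j" for i using v[of i] by auto
    then obtain p where p: "\<And>i. v i = b (p i)" by metis
    obtain m where m: "\<And>i. i \<in> fv \<phi> \<Longrightarrow> p i < m"
      using finite_fv[of \<phi>] finite_nat_bounded[of "p ` fv \<phi>"] by auto
    \<comment> \<open>Variable \<open>0\<close> is the witness, and variable \<open>Suc i\<close> is the point \<open>b i\<close>.\<close>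
    let ?q = "\<lambda>i. if i = x then 0 else Suc (p i)"
    define \<psi> where "\<psi> = subst_fm ?q \<phi>"
    have "\<psi> \<in> range (from_nat_into ?W)" unfolding W using \<phi> by (simp add: \<psi>_def)
    then obtain j where j: "\<psi> = from_nat_into ?W j" by blast
    define k where "k = prod_encode (j, m)"
    have \<psi>: "\<Phi> k = \<psi>" by (simp add: \<Phi>_def k_def j)
    have "m \<le> k" by (simp add: k_def le_prod_encode_2)
    have "fv \<psi> \<subseteq> ?q ` fv \<phi>" unfolding \<psi>_def by (rule fv_subst_fm)
    also have "\<dots> \<subseteq> {..<Suc k}" using m \<open>m \<le> k\<close> by force
    finally have mem: "\<Phi> k \<in> formulas \<sigma> (Suc k)"
      using \<phi> \<psi> by (simp add: formulas_def \<psi>_def)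
    have sat: "holds A \<psi> (d # F k) \<longleftrightarrow> sat A (v(x := d)) \<phi>" for d
      unfolding \<psi>_def sat_subst_fm F using m \<open>m \<le> k\<close>
      by (intro sat_cong) (fastforce simp: p)
    from Q[of k] ex mem obtain d where "F (Suc k) = F k @ [d]" "holds A \<psi> (d # F k)"
      unfolding Q_def \<psi> sat by blast
    then have "sat A (v(x := b k)) \<phi>" using step[of k] by (simp add: sat)
    then show ?thesis by blast
  qed
  show thesis
  proof
    show sub: "range b \<subseteq> carrier A" using b_in by auto
    show "isolated (map b [0..<k])" for k using P[of k] F[of k] by (simp add: P_def)
    show "sat (restrict_struct A (range b)) v \<phi> \<longleftrightarrow> sat A v \<phi>"
      if "wf_fm \<sigma> \<phi>" "\<And>i. v i \<in> range b" for \<phi> v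
      by (rule tarski_vaught[OF sub witness that])
  qed
qed

text \<open>The elementary substructure on the points of \<open>atomic_elementary_sequence\<close> is a countable model of
  the theory of \<open>A\<close>.  An isomorphism from \<open>A\<close> to it preserves types computed in \<open>A\<close>, so each tuple
  is conjugate to a tuple of the substructure.\<close>

lemma every_tuple_isolated:
  assumes a: "set a \<subseteq> carrier A"
  shows "isolated a"
proof -
  obtain b :: "nat \<Rightarrow> 'a" where b: "range b \<subseteq> carrier A" "\<And>k. isolated (map b [0..<k])"
    and elem: "\<And>\<phi> v. wf_fm \<sigma> \<phi> \<Longrightarrow> (\<And>i. v i \<in> range b)
      \<Longrightarrow> sat (restrict_struct A (range b)) v \<phi> \<longleftrightarrow> sat A v \<phi>"
    by (rule atomic_elementary_sequence) blast
  let ?X = "restrict_struct A (range b)"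
  have holds: "holds ?X \<phi> c \<longleftrightarrow> holds A \<phi> c"
    if "\<phi> \<in> formulas \<sigma> (length c)" "set c \<subseteq> range b" for \<phi> c
    by (rule elementary_holds[OF _ elem that]) auto
  have X: "carrier ?X = range b" by (simp add: restrict_struct_def)
  obtain f where f: "is_iso A ?X f"
  proof (rule countable_model_unique)
    show "is_struct \<sigma> ?X" by (rule is_struct_restrict[OF is_structure])
    show "countable (carrier ?X)" "carrier ?X \<noteq> {}" by (auto simp: X)
    show "holds ?X \<phi> []" if "\<phi> \<in> theory_of \<sigma> A" for \<phi>
      using holds[of \<phi> "[]"] that by (simp add: theory_of_def)
  qed
  have fa: "set (map f a) \<subseteq> range b" using is_iso_in[OF f] a X by auto
  have "type_of \<sigma> A (map f a) = type_of \<sigma> ?X (map f a)"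
    using holds[OF _ fa] by (auto simp: type_of_def)
  also have "\<dots> = type_of \<sigma> A a" by (rule type_of_is_iso[OF f a nonempty])
  finally have "orb (map f a) a" using fa b(1) a by (intro type_eq_orb) auto
  moreover obtain k where "set (map f a) \<subseteq> b ` {..<k}" using finite_subset_range[OF _ fa] by blast
  then have "isolated (map f a)"
    using b by (intro isolated_sublist[OF b(2)[of k]]) auto
  ultimately show ?thesis using isolated_orb fa b(1) by blast
qed

text \<open>The theorem of Ryll-Nardzewski.  Tuples of infinitely many different types would accumulate at
  some \<open>s\<close>; but a formula that isolates \<open>s\<close> holds for at most one of them.\<close>

theorem finite_types: "finite (type_of \<sigma> A ` {a. length a = n \<and> set a \<subseteq> carrier A})"
proof (rule ccontr)
  let ?T = "{a. length a = n \<and> set a \<subseteq> carrier A}"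
  assume "infinite (type_of \<sigma> A ` ?T)"
  then obtain p :: "nat \<Rightarrow> 'r fm set" where p: "inj p" "range p \<subseteq> type_of \<sigma> A ` ?T"
    using infinite_countable_subset by blast
  then have "\<exists>a \<in> ?T. type_of \<sigma> A a = p k" for k by (auto simp: image_iff subset_eq) metis
  then obtain t where t: "\<And>k. t k \<in> ?T" "\<And>k. type_of \<sigma> A (t k) = p k" by metis
  then obtain s where s: "length s = n" "set s \<subseteq> carrier A" and
    acc: "\<forall>\<phi> \<in> formulas \<sigma> n. holds A \<phi> s \<longrightarrow> infinite {k. holds A \<phi> (t k)}"
    using accumulation_tuple[of t n] by blast
  obtain \<theta> where \<theta>: "\<theta> \<in> formulas \<sigma> n" "holds A \<theta> s" and
    iso: "\<And>b. length b = n \<Longrightarrow> set b \<subseteq> carrier A \<Longrightarrow> holds A \<theta> b \<Longrightarrow> orb s b"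
    using every_tuple_isolated[OF s(2)] s by (auto simp: isolated_def)
  have "p k = type_of \<sigma> A s" if "holds A \<theta> (t k)" for k
    using iso[of "t k"] t[of k] orb_type[OF _ s(2)] that by auto
  then have "p ` {k. holds A \<theta> (t k)} \<subseteq> {type_of \<sigma> A s}" by blast
  then have "finite {k. holds A \<theta> (t k)}"
    using p(1) finite_subset finite_imageD inj_on_subset by (metis finite.simps subset_UNIV)
  with acc \<theta> show False by blast
qed

end

section \<open>Independence in terms of automorphisms\<close>

context categorical_structure
begin

text \<open>Independence with orbits in place of types; see \<open>indep_independent_from\<close>.\<close>

definition indep :: "'a set \<Rightarrow> 'a set \<Rightarrow> bool" where
  "indep P Q \<longleftrightarrow> (\<forall>a b c. set a \<subseteq> P \<and> set b \<subseteq> P \<and> set c \<subseteq> Q \<and> orb a b \<longrightarrow> orb (a @ c) (b @ c))"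

lemma indep_mono: "indep P Q \<Longrightarrow> P' \<subseteq> P \<Longrightarrow> Q' \<subseteq> Q \<Longrightarrow> indep P' Q'"
  unfolding indep_def by blast

text \<open>Only finitely many points of \<open>P\<close> and \<open>Q\<close> occur in given tuples, and automorphisms preserve conjugacy
  of tuples; so it is enough that all finite parts of \<open>P\<close> and \<open>Q\<close> have independent images.\<close>

lemma indep_finitary:
  assumes PQ: "P \<subseteq> carrier A" "Q \<subseteq> carrier A" and
    local: "\<And>p q. finite p \<Longrightarrow> finite q \<Longrightarrow> p \<subseteq> P \<Longrightarrow> q \<subseteq> Q
       \<Longrightarrow> \<exists>f. is_iso A A f \<and> indep (f ` p) (f ` q)"
  shows "indep P Q"
  unfolding indep_def
proof (intro allI impI)
  fix x y z assume xyz: "set x \<subseteq> P \<and> set y \<subseteq> P \<and> set z \<subseteq> Q \<and> orb x y"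
  then obtain f where f: "is_iso A A f" "indep (f ` (set x \<union> set y)) (f ` set z)"
    using local[of "set x \<union> set y" "set z"] by auto
  have car: "set x \<subseteq> carrier A" "set y \<subseteq> carrier A" "set z \<subseteq> carrier A" using xyz PQ by auto
  have "orb (map f x) (map f y)"
    using orb_trans[OF orb_map[OF f(1) car(1)] orb_trans[OF _ orbI[OF f(1)]]] xyz by blast
  moreover have "set (map f x) \<subseteq> f ` (set x \<union> set y)" "set (map f y) \<subseteq> f ` (set x \<union> set y)"
    "set (map f z) \<subseteq> f ` set z" by auto
  ultimately have "orb (map f x @ map f z) (map f y @ map f z)"
    using f(2) unfolding indep_def by blast
  then have "orb (map f (x @ z)) (map f (y @ z))" by simp
  moreover have "orb (x @ z) (map f (x @ z))" by (rule orbI[OF f(1)])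
  moreover have "orb (map f (y @ z)) (y @ z)" using car by (intro orb_map f(1)) auto
  ultimately show "orb (x @ z) (y @ z)" using orb_trans by blast
qed

lemma indep_independent_from:
  assumes "indep P Q" "P \<subseteq> carrier A" "Q \<subseteq> carrier A"
  shows "independent_from \<sigma> A P Q"
  unfolding independent_from_def
proof (intro allI impI)
  fix n a b
  assume ab: "length a = n \<and> set a \<subseteq> P \<and> length b = n \<and> set b \<subseteq> P"
    and type: "type_of \<sigma> A a = type_of \<sigma> A b"
  then have "orb a b" using assms(2) by (intro type_eq_orb) auto
  have "type_of \<sigma> A (a @ c) = type_of \<sigma> A (b @ c)" if c: "set c \<subseteq> Q" for c
  proof -
    have "orb (a @ c) (b @ c)" using assms(1) ab c \<open>orb a b\<close> unfolding indep_def by blast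
    then show ?thesis using orb_type[of "a @ c" "b @ c"] ab c assms(2,3) by auto
  qed
  then have "\<phi> \<in> formulas \<sigma> (n + length c) \<and> holds A \<phi> (a @ c)
      \<longleftrightarrow> \<phi> \<in> formulas \<sigma> (n + length c) \<and> holds A \<phi> (b @ c)" if "set c \<subseteq> Q" for \<phi> c
    using that ab by (fastforce simp: type_of_def set_eq_iff)
  then show "type_over \<sigma> A a Q = type_over \<sigma> A b Q"
    using ab by (auto simp: type_over_def)
qed

end

section \<open>The Ramsey property in terms of automorphisms\<close>

lemma embeddings_compose:
  assumes f: "f \<in> embeddings X Y" and g: "g \<in> embeddings Y Z"
  shows "compose (carrier X) g f \<in> embeddings X Z"
proof -
  have f_in: "f ` carrier X \<subseteq> carrier Y" and f_inj: "inj_on f (carrier X)"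
    using f by (auto simp: embeddings_def)
  have g_in: "g ` carrier Y \<subseteq> carrier Z" and g_inj: "inj_on g (carrier Y)"
    using g by (auto simp: embeddings_def)
  have "xs \<in> rel X R \<longleftrightarrow> map (compose (carrier X) g f) xs \<in> rel Z R"
    if xs: "set xs \<subseteq> carrier X" for R xs
  proof -
    have eq: "map (compose (carrier X) g f) xs = map g (map f xs)"
      using xs by (auto simp: compose_def)
    have "set (map f xs) \<subseteq> carrier Y" using xs f_in by auto
    then have "map f xs \<in> rel Y R \<longleftrightarrow> map g (map f xs) \<in> rel Z R"
      using g unfolding embeddings_def by blast
    moreover have "xs \<in> rel X R \<longleftrightarrow> map f xs \<in> rel Y R"
      using f xs unfolding embeddings_def by blast
    ultimately show ?thesis unfolding eq by blast
  qed
  moreover have "inj_on (compose (carrier X) g f) (carrier X)"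
    using comp_inj_on[OF f_inj inj_on_subset[OF g_inj f_in]]
    by (simp add: compose_def inj_on_def)
  moreover have "compose (carrier X) g f \<in> carrier X \<rightarrow>\<^sub>E carrier Z"
    using f_in g_in by (auto simp: compose_def)
  ultimately show ?thesis by (simp add: embeddings_def)
qed

lemma is_iso_restrict_embedding:
  assumes k: "is_iso A A k" and "S \<subseteq> carrier A" "k ` S \<subseteq> T"
  shows "restrict k S \<in> embeddings (restrict_struct A S) (restrict_struct A T)"
proof -
  have "xs \<in> rel (restrict_struct A S) R \<longleftrightarrow> map (restrict k S) xs \<in> rel (restrict_struct A T) R"
    if xs: "set xs \<subseteq> S" for R xs
  proof -
    have eq: "map (restrict k S) xs = map k xs" using xs by auto
    have "xs \<in> rel A R \<longleftrightarrow> map k xs \<in> rel A R"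
      using k xs assms(2) unfolding is_iso_def by blast
    then show ?thesis unfolding eq using xs assms(3) by (auto simp: restrict_struct_def)
  qed
  moreover have "inj_on k S"
    using k assms(2) by (auto simp: is_iso_def bij_betw_def intro: inj_on_subset)
  ultimately show ?thesis
    using assms(3) by (auto simp: embeddings_def restrict_struct_def)
qed

locale ramsey_structure = categorical_structure \<sigma> A
  for \<sigma> :: "'r signature" and A :: "('a, 'r) fo_struct" +
  assumes ramsey: "ramsey \<sigma> A"
begin

lemma restrict_in_age:
  assumes "finite S" "S \<subseteq> carrier A"
  shows "restrict_struct A S \<in> age \<sigma> A"
proof -
  have "restrict (\<lambda>x. x) S \<in> embeddings (restrict_struct A S) (restrict_struct A (carrier A))"
    using assms by (intro is_iso_restrict_embedding is_iso_id) auto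
  moreover have "restrict_struct A (carrier A) = A"
    using is_structure by (auto simp: restrict_struct_def is_struct_def intro!: fo_struct.equality)
  ultimately show ?thesis
    using assms(1) is_struct_restrict[OF is_structure, of S]
    by (auto simp: age_def) (simp add: restrict_struct_def)
qed

lemma embedding_extends:
  assumes "finite S" "S \<subseteq> carrier A" "f \<in> embeddings (restrict_struct A S) A"
  obtains g where "is_iso A A g" "\<And>x. x \<in> S \<Longrightarrow> g x = f x"
proof (rule extend_partial_iso[OF assms(1,2), of f])
  show "inj_on f S" "f ` S \<subseteq> carrier A"
    using assms(3) by (auto simp: embeddings_def restrict_struct_def)
  show "xs \<in> rel A R \<longleftrightarrow> map f xs \<in> rel A R" if "set xs \<subseteq> S" for R xs
    using assms(3) that by (auto simp: embeddings_def restrict_struct_def)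
qed (rule that)

text \<open>The Ramsey property for subsets of \<open>A\<close>.  The copies of \<open>x\<close> are the tuples in its orbit, and the
  copies of \<open>S\<close> are its images under automorphisms: by homogeneity every embedding of a finite substructure
  extends to an automorphism, and an abstract \<open>Z\<close> of the age can be replaced by its image in \<open>A\<close>.\<close>

lemma ramsey_copies:
  fixes K :: "'c set"
  assumes x: "set x \<subseteq> carrier A" and S: "finite S" "S \<subseteq> carrier A" and K: "finite K"
  obtains Z where "finite Z" "Z \<subseteq> carrier A"
    "\<forall>\<chi>. (\<forall>y. orb x y \<longrightarrow> \<chi> y \<in> K) \<longrightarrow>
       (\<exists>g. is_iso A A g \<and> g ` S \<subseteq> Z \<and>
         (\<forall>y y'. orb x y \<and> orb x y' \<and> set y \<subseteq> g ` S \<and> set y' \<subseteq> g ` S \<longrightarrow> \<chi> y = \<chi> y'))"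
proof -
  let ?X = "restrict_struct A (set x)" and ?Y = "restrict_struct A S"
  have cX: "carrier ?X = set x" and cY: "carrier ?Y = S" by (auto simp: restrict_struct_def)
  obtain Z where Z: "Z \<in> age \<sigma> A" "arrows Z ?Y ?X (card K)"
    using ramsey restrict_in_age[of "set x"] restrict_in_age[OF S] x unfolding ramsey_def by blast
  then obtain z where z: "z \<in> embeddings Z A" by (auto simp: age_def)
  obtain \<iota> where \<iota>: "bij_betw \<iota> K {1..card K}"
    using finite_same_card_bij[OF K finite_atLeastAtMost[of 1 "card K"]] by auto
  have "\<exists>g. is_iso A A g \<and> g ` S \<subseteq> z ` carrier Z \<and>
         (\<forall>y y'. orb x y \<and> orb x y' \<and> set y \<subseteq> g ` S \<and> set y' \<subseteq> g ` S \<longrightarrow> \<chi> y = \<chi> y')"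
    if \<chi>: "\<forall>y. orb x y \<longrightarrow> \<chi> y \<in> K" for \<chi> :: "'a list \<Rightarrow> 'c"
  proof -
    define \<kappa> where "\<kappa> f = \<iota> (\<chi> (map (\<lambda>s. z (f s)) x))" for f
    have "\<kappa> f \<in> {1..card K}" if f: "f \<in> embeddings ?X Z" for f
    proof -
      obtain g where g: "is_iso A A g" "\<And>s. s \<in> set x \<Longrightarrow> g s = compose (carrier ?X) z f s"
        using embedding_extends[OF finite_set x, of "compose (carrier ?X) z f"]
          embeddings_compose[OF f z] by blast
      then have "map (\<lambda>s. z (f s)) x = map g x" by (simp add: compose_def cX)
      then have "orb x (map (\<lambda>s. z (f s)) x)" using orbI[OF g(1), of x] by metis
      with \<chi> \<iota> show ?thesis by (auto simp: \<kappa>_def bij_betw_def)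
    qed
    then obtain e c where e: "e \<in> embeddings ?Y Z"
      and c: "\<And>f. f \<in> embeddings ?X ?Y \<Longrightarrow> \<kappa> (compose (carrier ?X) e f) = c"
      using Z(2) unfolding arrows_def by blast
    obtain g where g: "is_iso A A g" "\<And>s. s \<in> S \<Longrightarrow> g s = z (e s)"
      using embedding_extends[OF S embeddings_compose[OF e z]] by (auto simp: compose_def cY)
    have "g ` S \<subseteq> z ` carrier Z" using e g(2) by (auto simp: embeddings_def cY)
    have col: "\<iota> (\<chi> y) = c" if y: "orb x y" "set y \<subseteq> g ` S" for y
    proof -
      obtain h where h: "is_iso A A h" "y = map h x" using y(1) by (auto simp: orb_def)
      \<comment> \<open>The copy \<open>y = h x\<close> inside \<open>g S\<close>
        comes from an embedding of \<open>x\<close> into \<open>S\<close>, so its colour is the constant \<open>c\<close>.\<close>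
      let ?k = "inv_into (carrier A) g \<circ> h"
      have k: "?k s \<in> S \<and> g (?k s) = h s" if "s \<in> set x" for s
      proof -
        have "h s \<in> g ` S" using y(2) that unfolding h(2) set_map by blast
        then obtain s' where s': "s' \<in> S" "h s = g s'" by blast
        then have "?k s = s'"
          using g(1) S(2) by (auto simp: is_iso_def bij_betw_inv_into_left)
        with s' show ?thesis by simp
      qed
      have "is_iso A A ?k" using is_iso_comp[OF h(1) is_iso_inv[OF g(1)]] .
      then have "restrict ?k (set x) \<in> embeddings ?X ?Y"
        using k x by (intro is_iso_restrict_embedding) auto
      from c[OF this] have "\<iota> (\<chi> (map (\<lambda>s. z (e (?k s))) x)) = c"
        by (simp add: \<kappa>_def compose_def cX cong: map_cong)
      moreover have "map (\<lambda>s. z (e (?k s))) x = y"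
        using k g(2) h(2) by (auto simp del: o_apply) metis
      ultimately show ?thesis by simp
    qed
    have "\<chi> y = \<chi> y'"
      if "orb x y \<and> orb x y' \<and> set y \<subseteq> g ` S \<and> set y' \<subseteq> g ` S" for y y'
    proof -
      have "\<iota> (\<chi> y) = \<iota> (\<chi> y')" "\<chi> y \<in> K" "\<chi> y' \<in> K" using col that \<chi> by auto
      then show ?thesis using \<iota> by (auto simp: bij_betw_def dest: inj_onD)
    qed
    with g(1) \<open>g ` S \<subseteq> z ` carrier Z\<close> show ?thesis by blast
  qed
  moreover have "finite (z ` carrier Z)" "z ` carrier Z \<subseteq> carrier A"
    using Z(1) z by (auto simp: age_def embeddings_def)
  ultimately show thesis using that[of "z ` carrier Z"] by blast
qed

text \<open>The Ramsey property for several tuples \<open>x\<close> simultaneously, and the colouring by types over \<open>c\<close>.  For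
  a further tuple \<open>x\<close>, a set \<open>Z\<^sub>1\<close> that is large enough for the copies of \<open>x\<close> in \<open>S\<close> takes the
  place of \<open>S\<close> in the induction hypothesis; a monochromatic copy of \<open>S\<close> inside the good copy
  of \<open>Z\<^sub>1\<close> is good for all tuples.  The set \<open>Z\<close> is found before \<open>c\<close> is given, because the number of
  colours depends only on the length of \<open>c\<close>.\<close>

lemma homogenize_tuples:
  assumes "finite L" "\<forall>x \<in> L. set x \<subseteq> carrier A" "finite S" "S \<subseteq> carrier A"
  shows "\<exists>Z. finite Z \<and> Z \<subseteq> carrier A \<and>
    (\<forall>c. length c = m \<and> set c \<subseteq> carrier A \<longrightarrow>
      (\<exists>g. is_iso A A g \<and> g ` S \<subseteq> Z \<and>
        (\<forall>x \<in> L. \<forall>y y'. orb x y \<and> orb x y' \<and> set y \<subseteq> g ` S \<and> set y' \<subseteq> g ` S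
           \<longrightarrow> type_of \<sigma> A (y @ c) = type_of \<sigma> A (y' @ c))))"
  using assms
proof (induction L arbitrary: S rule: finite_induct)
  case empty
  then show ?case using is_iso_id by (intro exI[of _ S]) (auto intro!: exI[of _ "\<lambda>x. x"])
next
  case (insert x L)
  let ?K = "type_of \<sigma> A ` {a. length a = length x + m \<and> set a \<subseteq> carrier A}"
  from insert.prems have x: "set x \<subseteq> carrier A" and S: "finite S" "S \<subseteq> carrier A" by auto
  obtain Z\<^sub>1 where Z1: "finite Z\<^sub>1" "Z\<^sub>1 \<subseteq> carrier A" and
    mono: "\<forall>\<chi>. (\<forall>y. orb x y \<longrightarrow> \<chi> y \<in> ?K) \<longrightarrow>
       (\<exists>g. is_iso A A g \<and> g ` S \<subseteq> Z\<^sub>1 \<and>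
         (\<forall>y y'. orb x y \<and> orb x y' \<and> set y \<subseteq> g ` S \<and> set y' \<subseteq> g ` S \<longrightarrow> \<chi> y = \<chi> y'))"
    by (rule ramsey_copies[OF x S finite_types[of "length x + m"]])
  obtain Z where Z: "finite Z" "Z \<subseteq> carrier A" and
    IH: "\<And>c. length c = m \<Longrightarrow> set c \<subseteq> carrier A \<Longrightarrow>
      (\<exists>g. is_iso A A g \<and> g ` Z\<^sub>1 \<subseteq> Z \<and>
        (\<forall>x \<in> L. \<forall>y y'. orb x y \<and> orb x y' \<and> set y \<subseteq> g ` Z\<^sub>1 \<and> set y' \<subseteq> g ` Z\<^sub>1
           \<longrightarrow> type_of \<sigma> A (y @ c) = type_of \<sigma> A (y' @ c)))"
    using insert.IH[OF _ Z1] insert.prems(1) by auto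
  have "\<exists>g. is_iso A A g \<and> g ` S \<subseteq> Z \<and>
        (\<forall>x \<in> insert x L. \<forall>y y'. orb x y \<and> orb x y' \<and> set y \<subseteq> g ` S \<and> set y' \<subseteq> g ` S
           \<longrightarrow> type_of \<sigma> A (y @ c) = type_of \<sigma> A (y' @ c))"
    if c: "length c = m" "set c \<subseteq> carrier A" for c
  proof -
    obtain g where g: "is_iso A A g" "g ` Z\<^sub>1 \<subseteq> Z" and
      gL: "\<forall>x \<in> L. \<forall>y y'. orb x y \<and> orb x y' \<and> set y \<subseteq> g ` Z\<^sub>1 \<and> set y' \<subseteq> g ` Z\<^sub>1
           \<longrightarrow> type_of \<sigma> A (y @ c) = type_of \<sigma> A (y' @ c)" using IH[OF c] by blast
    let ?\<chi> = "\<lambda>y. type_of \<sigma> A (map g y @ c)"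
    have "?\<chi> y \<in> ?K" if "orb x y" for y
    proof (rule imageI)
      have "set (map g y) \<subseteq> carrier A"
        using orb_carrier[OF orbI[OF g(1)] orb_carrier[OF that x]] .
      then show "map g y @ c \<in> {a. length a = length x + m \<and> set a \<subseteq> carrier A}"
        using c orb_length[OF that] by auto
    qed
    then obtain h where h: "is_iso A A h" "h ` S \<subseteq> Z\<^sub>1" and
      hx: "\<forall>y y'. orb x y \<and> orb x y' \<and> set y \<subseteq> h ` S \<and> set y' \<subseteq> h ` S \<longrightarrow> ?\<chi> y = ?\<chi> y'"
      using spec[OF mono, of ?\<chi>] by blast
    have gh: "is_iso A A (g \<circ> h)" by (rule is_iso_comp[OF h(1) g(1)])
    have pull: "\<exists>w. orb x w \<and> set w \<subseteq> h ` S \<and> map g w = y"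
      if y: "orb x y" "set y \<subseteq> (g \<circ> h) ` S" for y
    proof -
      let ?g' = "inv_into (carrier A) g"
      have left: "?g' (g s) = s" if "s \<in> h ` S" for s
        using g(1) h(2) Z1(2) that by (intro bij_betw_inv_into_left) (auto simp: is_iso_def)
      have "set (map ?g' y) \<subseteq> h ` S" using y(2) left by auto
      moreover have "map g (map ?g' y) = y"
        using y(2) left by (auto intro!: map_idI)
      moreover have "orb x (map ?g' y)"
        by (rule orb_trans[OF y(1) orbI[OF is_iso_inv[OF g(1)]]])
      ultimately show ?thesis by blast
    qed
    have new: "type_of \<sigma> A (y @ c) = type_of \<sigma> A (y' @ c)"
      if "orb x y" "orb x y'" "set y \<subseteq> (g \<circ> h) ` S" "set y' \<subseteq> (g \<circ> h) ` S" for y y'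
      using pull[OF that(1,3)] pull[OF that(2,4)] hx by blast
    have sub: "(g \<circ> h) ` S \<subseteq> g ` Z\<^sub>1" using h(2) by auto
    show ?thesis
    proof (intro exI[of _ "g \<circ> h"] conjI ballI allI impI gh)
      show "(g \<circ> h) ` S \<subseteq> Z" using sub g(2) by (rule order_trans)
      fix x' y y'
      assume x': "x' \<in> insert x L" and
        y: "orb x' y \<and> orb x' y' \<and> set y \<subseteq> (g \<circ> h) ` S \<and> set y' \<subseteq> (g \<circ> h) ` S"
      show "type_of \<sigma> A (y @ c) = type_of \<sigma> A (y' @ c)"
      proof (cases "x' = x")
        case True
        with y new show ?thesis by blast
      next
        case False
        with x' have "x' \<in> L" by simp
        moreover have "set y \<subseteq> g ` Z\<^sub>1" "set y' \<subseteq> g ` Z\<^sub>1" using y sub by (meson order_trans)+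
        ultimately show ?thesis using gL y by simp
      qed
    qed
  qed
  with Z show ?case by blast
qed

text \<open>It suffices to treat the tuples without repetitions: two conjugate tuples of a copy of \<open>S\<close> are
  determined by their \<open>remdups\<close>, which are copies of the same tuple without repetitions.\<close>

lemma copy_independent_from_tuple:
  assumes S: "finite S" "S \<subseteq> carrier A"
  obtains Z where "finite Z" "Z \<subseteq> carrier A"
    "\<And>c. length c = m \<Longrightarrow> set c \<subseteq> carrier A \<Longrightarrow> \<exists>g. is_iso A A g \<and> g ` S \<subseteq> Z \<and> indep (g ` S) (set c)"
proof -
  let ?L = "{x. set x \<subseteq> S \<and> distinct x}"
  have L: "\<forall>x \<in> ?L. set x \<subseteq> carrier A" using S(2) by auto
  obtain Z where Z: "finite Z" "Z \<subseteq> carrier A" and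
    hom: "\<forall>c. length c = m \<and> set c \<subseteq> carrier A \<longrightarrow>
      (\<exists>g. is_iso A A g \<and> g ` S \<subseteq> Z \<and>
        (\<forall>x \<in> ?L. \<forall>y y'. orb x y \<and> orb x y' \<and> set y \<subseteq> g ` S \<and> set y' \<subseteq> g ` S
           \<longrightarrow> type_of \<sigma> A (y @ c) = type_of \<sigma> A (y' @ c)))"
    using homogenize_tuples[OF finite_subset_distinct[OF S(1)] L S, of m] by (elim exE conjE)
  have "\<exists>g. is_iso A A g \<and> g ` S \<subseteq> Z \<and> indep (g ` S) (set c)"
    if c: "length c = m" "set c \<subseteq> carrier A" for c
  proof -
    obtain g where g: "is_iso A A g" "g ` S \<subseteq> Z" and
      gL: "\<forall>x \<in> ?L. \<forall>y y'. orb x y \<and> orb x y' \<and> set y \<subseteq> g ` S \<and> set y' \<subseteq> g ` S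
           \<longrightarrow> type_of \<sigma> A (y @ c) = type_of \<sigma> A (y' @ c)"
      using spec[OF hom, of c] c by (elim impE exE conjE) simp_all
    let ?g' = "inv_into (carrier A) g"
    have left: "?g' (g s) = s" if "s \<in> S" for s
      using g(1) S(2) that by (intro bij_betw_inv_into_left) (auto simp: is_iso_def)
    have gS: "g ` S \<subseteq> carrier A" using g(2) Z(2) by blast
    have "orb (a @ d) (b @ d)"
      if a: "set a \<subseteq> g ` S" and b: "set b \<subseteq> g ` S" and d: "set d \<subseteq> set c" and "orb a b" for a b d
    proof -
      obtain h where h: "is_iso A A h" "map h a = b" using \<open>orb a b\<close> by (auto simp: orb_def)
      let ?y = "remdups a"
      have y: "set ?y \<subseteq> g ` S" "set (map h ?y) \<subseteq> g ` S" using a b h(2) by auto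
      have right: "g (?g' t) = t" if "t \<in> set a" for t using a that left by auto
      then have "inj_on ?g' (set a)" by (rule inj_on_inverseI)
      moreover have "?g' ` set a \<subseteq> S" using a left by auto
      ultimately have "map ?g' ?y \<in> ?L" by (simp add: distinct_map)
      moreover have "map g (map ?g' ?y) = ?y" using right by (auto intro!: map_idI)
      then have "orb (map ?g' ?y) ?y" using orbI[OF g(1), of "map ?g' ?y"] by simp
      moreover from this have "orb (map ?g' ?y) (map h ?y)" using orbI[OF h(1)] orb_trans by blast
      ultimately have "type_of \<sigma> A (?y @ c) = type_of \<sigma> A (map h ?y @ c)"
        using bspec[OF gL, of "map ?g' ?y"] y by blast
      then have "orb (?y @ c) (map h ?y @ c)"
        using y gS c by (intro type_eq_orb) auto
      then obtain k where k: "is_iso A A k" "map k ?y = map h ?y" "map k c = c"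
        by (auto simp: orb_def append_eq_append_conv)
      have "k s = h s" if "s \<in> set a" for s using k(2) that by simp
      moreover have "k s = s" if "s \<in> set d" for s
        using k(3) d that by (metis map_eq_conv list.map_id0 map_idI subsetD id_apply)
      ultimately have "map k (a @ d) = b @ d" using h(2) by (auto intro!: map_idI)
      with k(1) show ?thesis by (auto simp: orb_def)
    qed
    then have "indep (g ` S) (set c)" unfolding indep_def by blast
    with g show ?thesis by blast
  qed
  with Z that show thesis by blast
qed

text \<open>The roles are not symmetric: \<open>Z\<close> is chosen so as to contain a copy of \<open>S\<close> independent from any
  given tuple as long as \<open>S\<close>.  A copy of \<open>S\<close> independent from all of \<open>Z\<close> comes next, and
  its enumeration is the tuple given to \<open>Z\<close>.\<close>

lemma independent_copies:
  assumes S: "finite S" "S \<subseteq> carrier A"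
  obtains g h where "is_iso A A g" "is_iso A A h" "indep (g ` S) (h ` S)" "indep (h ` S) (g ` S)"
proof -
  obtain l where l: "set l = S" using finite_list[OF S(1)] by blast
  obtain Z where Z: "finite Z" "Z \<subseteq> carrier A" and
    copy: "\<And>c. length c = length l \<Longrightarrow> set c \<subseteq> carrier A
      \<Longrightarrow> \<exists>h. is_iso A A h \<and> h ` S \<subseteq> Z \<and> indep (h ` S) (set c)"
    using copy_independent_from_tuple[OF S, of "length l"] by blast
  obtain z where z: "set z = Z" using finite_list[OF Z(1)] by blast
  obtain g where g: "is_iso A A g" "indep (g ` S) Z"
    using copy_independent_from_tuple[OF S, of "length z"] z Z(2) by metis
  have gl: "set (map g l) = g ` S" by (simp add: l)
  then have "set (map g l) \<subseteq> carrier A" using orb_carrier[OF orbI[OF g(1)], of l] l S(2) by simp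
  then obtain h where h: "is_iso A A h" "h ` S \<subseteq> Z" "indep (h ` S) (g ` S)"
    using copy[of "map g l"] gl by auto
  show thesis by (rule that[OF g(1) h(1) indep_mono[OF g(2) order_refl h(2)] h(3)])
qed

end

section \<open>Infinite independent copies\<close>

context categorical_structure
begin

text \<open>Koenig's lemma.  A tuple that is conjugate to initial segments of infinitely many of the sequences
  \<open>D n\<close> can be prolonged, since the next longer initial segments fall into finitely many orbits.\<close>

lemma sequence_compactness:
  fixes D :: "nat \<Rightarrow> nat \<Rightarrow> 'a"
  assumes D: "\<And>n i. D n i \<in> carrier A"
  obtains s :: "nat \<Rightarrow> 'a" where "range s \<subseteq> carrier A"
    "\<And>k. infinite {n. orb (map s [0..<k]) (map (D n) [0..<k])}"
proof -
  define P where "P = (\<lambda>k l. length l = k \<and> set l \<subseteq> carrier A \<and>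
    infinite {n. orb l (map (D n) [0..<k])})"
  define Q where "Q = (\<lambda>(k::nat) l l'. \<exists>d::'a. l' = l @ [d])"
  have "\<exists>F. \<forall>k. P k (F k) \<and> Q k (F k) (F (Suc k))"
  proof (rule dependent_nat_choice)
    have "orb [] []" using orbI[OF is_iso_id, of "[]"] by simp
    then show "\<exists>l. P 0 l" by (simp add: P_def)
    fix l k assume P: "P k l"
    let ?N = "{n. orb l (map (D n) [0..<k])}" and ?D = "\<lambda>n. map (D n) [0..<Suc k]"
    have D_in: "set (?D n) \<subseteq> carrier A" for n using D by auto
    have "(\<lambda>n. type_of \<sigma> A (?D n)) ` ?N
        \<subseteq> type_of \<sigma> A ` {a. length a = Suc k \<and> set a \<subseteq> carrier A}"
      using D_in by (auto simp del: upt_Suc)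
    then have "finite ((\<lambda>n. type_of \<sigma> A (?D n)) ` ?N)"
      by (rule finite_subset[OF _ finite_types])
    moreover have "infinite ?N" using P by (simp add: P_def)
    ultimately obtain n where n: "n \<in> ?N"
      and inf: "infinite {n' \<in> ?N. type_of \<sigma> A (?D n') = type_of \<sigma> A (?D n)}"
      using pigeonhole_infinite by blast
    have "orb (map (D n) [0..<k]) l" using n P by (auto simp: P_def intro: orb_sym)
    then obtain g where g: "is_iso A A g" "map g (map (D n) [0..<k]) = l" by (auto simp: orb_def)
    let ?l = "l @ [g (D n k)]"
    have gl: "map g (?D n) = ?l" using g(2) by simp
    have "orb ?l (?D n)" using orb_map[OF g(1) D_in, of n] gl by simp
    moreover have "orb (?D n) (?D n')" if "type_of \<sigma> A (?D n') = type_of \<sigma> A (?D n)" for n'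
      using that by (intro type_eq_orb D_in) auto
    ultimately have "{n' \<in> ?N. type_of \<sigma> A (?D n') = type_of \<sigma> A (?D n)} \<subseteq> {n'. orb ?l (?D n')}"
      using orb_trans by blast
    with inf have "infinite {n'. orb ?l (?D n')}" using finite_subset by blast
    moreover have "set ?l \<subseteq> carrier A"
      unfolding gl[symmetric] by (rule orb_carrier[OF orbI[OF g(1)] D_in])
    ultimately have "P (Suc k) ?l" "Q k l ?l" using P by (auto simp: P_def Q_def)
    then show "\<exists>l'. P (Suc k) l' \<and> Q k l l'" by blast
  qed
  then obtain F where P: "\<And>k. P k (F k)" and Q: "\<And>k. Q k (F k) (F (Suc k))" by blast
  define s where "s k = F (Suc k) ! k" for k
  have step: "F (Suc k) = F k @ [s k]" for k
    using P[of k] Q[of k] by (auto simp: P_def Q_def s_def nth_append)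
  have F: "F k = map s [0..<k]" for k
  proof (induction k)
    case 0
    show ?case using P[of 0] by (simp add: P_def)
  qed (simp add: step)
  have "s k \<in> carrier A" for k using P[of "Suc k"] step[of k] by (simp add: P_def)
  moreover have "infinite {n. orb (map s [0..<k]) (map (D n) [0..<k])}" for k
    using P[of k] F[of k] by (simp add: P_def)
  ultimately show thesis using that by blast
qed

text \<open>A witness in \<open>A\<close> for a formula with parameters from \<open>s\<close> is pulled back along one automorphism to
  some \<open>a j\<close>, and then \<open>s j\<close> is a witness as well by another automorphism, which covers \<open>a j\<close> and the
  parameters.\<close>

lemma elementary_copy:
  fixes a s :: "nat \<Rightarrow> 'a"
  assumes a: "range a = carrier A" and s: "\<And>k. orb (map a [0..<k]) (map s [0..<k])"
  shows "elementary_substructure \<sigma> (restrict_struct A (range s)) A"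
proof -
  have iso: "\<exists>h. is_iso A A h \<and> (\<forall>i<k. h (a i) = s i)" for k
    using s[of k] by (auto simp: orb_def)
  have s_in: "s i \<in> carrier A" for i
  proof -
    obtain h where "is_iso A A h" "h (a i) = s i" using iso[of "Suc i"] by auto
    then show ?thesis using is_iso_in[of A A h "a i"] a by auto
  qed
  then have sub: "range s \<subseteq> carrier A" by blast
  have witness: "\<exists>d \<in> range s. sat A (v(x := d)) \<phi>"
    if \<phi>: "wf_fm \<sigma> \<phi>" and v: "\<And>i. v i \<in> range s" and ex: "\<exists>d \<in> carrier A. sat A (v(x := d)) \<phi>"
    for \<phi> x v
  proof -
    have "\<exists>j. v i = s j" for i using v[of i] by auto
    then obtain p where p: "\<And>i. v i = s (p i)" by metis
    obtain m where m: "\<And>i. i \<in> fv \<phi> \<Longrightarrow> p i < m"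
      using finite_fv[of \<phi>] finite_nat_bounded[of "p ` fv \<phi>"] by auto
    have transfer: "sat A (v(x := h d)) \<phi> \<longleftrightarrow> sat A ((a \<circ> p)(x := d)) \<phi>"
      if h: "is_iso A A h" "\<forall>i<m. h (a i) = s i" and d: "d \<in> carrier A" for h d
    proof -
      have "sat A ((a \<circ> p)(x := d)) \<phi> \<longleftrightarrow> sat A (h \<circ> (a \<circ> p)(x := d)) \<phi>"
        using d a by (intro is_iso_sat[OF h(1)]) auto
      also have "\<dots> \<longleftrightarrow> sat A (v(x := h d)) \<phi>"
        using m h(2) by (intro sat_cong) (auto simp: p)
      finally show ?thesis by simp
    qed
    obtain h where h: "is_iso A A h" "\<forall>i<m. h (a i) = s i" using iso by blast
    obtain d where d: "d \<in> carrier A" "sat A (v(x := d)) \<phi>" using ex by blast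
    have "h ` carrier A = carrier A" using h(1) by (simp add: is_iso_def bij_betw_def)
    with d(1) have "d \<in> h ` carrier A" by simp
    then obtain e where e: "e \<in> carrier A" "h e = d" by (elim imageE) simp
    then obtain j where j: "e = a j" using a by auto
    have "sat A ((a \<circ> p)(x := a j)) \<phi>" using transfer[OF h e(1)] e(2) d(2) j by simp
    moreover obtain h' where "is_iso A A h'" "\<forall>i<max m (Suc j). h' (a i) = s i" using iso by blast
    ultimately have "sat A (v(x := s j)) \<phi>" using transfer[of h' "a j"] e(1) j by auto
    then show ?thesis by blast
  qed
  show ?thesis
  proof (rule elementary_substructureI[OF sub])
    show "sat (restrict_struct A (range s)) v \<phi> \<longleftrightarrow> sat A v \<phi>"
      if "wf_fm \<sigma> \<phi>" "\<And>i. v i \<in> range s" for \<phi> v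
      by (rule tarski_vaught[OF sub witness that])
  qed simp
qed

end

context ramsey_structure
begin

text \<open>The two sequences of copies are interleaved: the limit sequence has the points of the first
  substructure at even and those of the second at odd positions.\<close>

lemma independent_elementary_substructures:
  "\<exists>B C. elementary_substructure \<sigma> B A \<and> elementary_substructure \<sigma> C A \<and>
     independent_substructures \<sigma> A B C"
proof -
  define a where "a = from_nat_into (carrier A)"
  have a: "range a = carrier A"
    unfolding a_def by (rule range_from_nat_into[OF nonempty countable_carrier])
  have "\<exists>g h. is_iso A A g \<and> is_iso A A h \<and>
      indep (g ` a ` {..<n}) (h ` a ` {..<n}) \<and> indep (h ` a ` {..<n}) (g ` a ` {..<n})" for n :: nat
  proof -
    have "finite (a ` {..<n})" "a ` {..<n} \<subseteq> carrier A" using a by auto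
    then show ?thesis by (rule independent_copies) blast
  qed
  then obtain g h where g: "\<And>n. is_iso A A (g n)" and h: "\<And>n. is_iso A A (h n)" and
    gh: "\<And>n :: nat. indep (g n ` a ` {..<n}) (h n ` a ` {..<n})"
        "\<And>n :: nat. indep (h n ` a ` {..<n}) (g n ` a ` {..<n})" by metis
  have a_in: "a i \<in> carrier A" for i using a by auto
  define D where "D n i = (if even i then g n else h n) (a (i div 2))" for n i
  have "D n i \<in> carrier A" for n i
    using is_iso_in[OF g a_in] is_iso_in[OF h a_in] by (simp add: D_def)
  then obtain s where s: "range s \<subseteq> carrier A" and
    inf: "\<And>k. infinite {n. orb (map s [0..<k]) (map (D n) [0..<k])}"
    using sequence_compactness[of D] by blast
  define b c where "b i = s (2 * i)" and "c i = s (2 * i + 1)" for i :: nat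
  have approx: "\<exists>n f. n \<ge> k \<and> is_iso A A f \<and> (\<forall>i<k. f (b i) = g n (a i) \<and> f (c i) = h n (a i))" for k
  proof -
    obtain n where n: "n \<ge> k" "orb (map s [0..<2 * k]) (map (D n) [0..<2 * k])"
      using inf[of "2 * k"] by (auto simp: infinite_nat_iff_unbounded_le)
    then obtain f where f: "is_iso A A f" "\<And>i. i < 2 * k \<Longrightarrow> f (s i) = D n i"
      by (auto simp: orb_def)
    then have "\<forall>i<k. f (b i) = g n (a i) \<and> f (c i) = h n (a i)"
      by (simp add: b_def c_def D_def)
    with n f show ?thesis by blast
  qed
  have b_in: "b i \<in> carrier A" and c_in: "c i \<in> carrier A" for i
    using s by (auto simp: b_def c_def)
  have copy: "orb (map a [0..<k]) (map t [0..<k])"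
    if "is_iso A A f" "is_iso A A g" "\<And>i. i < k \<Longrightarrow> f (t i) = g (a i)" "\<And>i. t i \<in> carrier A" for f g t k
  proof -
    have "map g (map a [0..<k]) = map f (map t [0..<k])" using that(3) by simp
    moreover have "orb (map f (map t [0..<k])) (map t [0..<k])"
      using that(4) by (intro orb_map that(1)) auto
    ultimately show ?thesis using orb_trans[OF orbI[OF that(2)], of "map a [0..<k]"] by metis
  qed
  have elem_b: "elementary_substructure \<sigma> (restrict_struct A (range b)) A"
  proof (rule elementary_copy[OF a])
    fix k
    obtain n f where "is_iso A A f" "\<forall>i<k. f (b i) = g n (a i)" using approx[of k] by blast
    then show "orb (map a [0..<k]) (map b [0..<k])" by (intro copy[OF _ g[of n]] b_in) auto
  qed
  have elem_c: "elementary_substructure \<sigma> (restrict_struct A (range c)) A"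
  proof (rule elementary_copy[OF a])
    fix k
    obtain n f where "is_iso A A f" "\<forall>i<k. f (c i) = h n (a i)" using approx[of k] by blast
    then show "orb (map a [0..<k]) (map c [0..<k])" by (intro copy[OF _ h[of n]] c_in) auto
  qed
  have stage: "\<exists>n f. is_iso A A f \<and> f ` p \<subseteq> g n ` a ` {..<n} \<and> f ` q \<subseteq> h n ` a ` {..<n}"
    if pq: "finite p" "finite q" "p \<subseteq> range b" "q \<subseteq> range c" for p q
  proof -
    obtain j where j: "p \<subseteq> b ` {..<j}" using finite_subset_range[OF pq(1,3)] .
    obtain k where k: "q \<subseteq> c ` {..<k}" using finite_subset_range[OF pq(2,4)] .
    obtain n f where nf: "n \<ge> max j k" "is_iso A A f"
      "\<forall>i<max j k. f (b i) = g n (a i) \<and> f (c i) = h n (a i)" using approx[of "max j k"] by blast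
    have "f y \<in> g n ` a ` {..<n}" if y: "y \<in> p" for y
    proof -
      obtain i where "y = b i" "i < j" using j y by blast
      with nf have "f y = g n (a i)" "i < n" by auto
      then show ?thesis by blast
    qed
    moreover have "f y \<in> h n ` a ` {..<n}" if y: "y \<in> q" for y
    proof -
      obtain i where "y = c i" "i < k" using k y by blast
      with nf have "f y = h n (a i)" "i < n" by auto
      then show ?thesis by blast
    qed
    ultimately show ?thesis using nf(2) by blast
  qed
  have sub: "range b \<subseteq> carrier A" "range c \<subseteq> carrier A" using b_in c_in by auto
  have "indep (range b) (range c)"
  proof (rule indep_finitary[OF sub])
    fix p q assume pq: "finite p" "finite q" "p \<subseteq> range b" "q \<subseteq> range c"
    obtain n f where f: "is_iso A A f" "f ` p \<subseteq> g n ` a ` {..<n}" "f ` q \<subseteq> h n ` a ` {..<n}"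
      using stage[OF pq] by (elim exE conjE)
    show "\<exists>f. is_iso A A f \<and> indep (f ` p) (f ` q)"
      by (intro exI[of _ f] conjI f(1) indep_mono[OF gh(1) f(2,3)])
  qed
  moreover have "indep (range c) (range b)"
  proof (rule indep_finitary[OF sub(2,1)])
    fix q p assume pq: "finite q" "finite p" "q \<subseteq> range c" "p \<subseteq> range b"
    obtain n f where f: "is_iso A A f" "f ` p \<subseteq> g n ` a ` {..<n}" "f ` q \<subseteq> h n ` a ` {..<n}"
      using stage[OF pq(2,1,4,3)] by (elim exE conjE)
    show "\<exists>f. is_iso A A f \<and> indep (f ` q) (f ` p)"
      by (intro exI[of _ f] conjI f(1) indep_mono[OF gh(2) f(3,2)])
  qed
  ultimately have "independent_substructures \<sigma> A (restrict_struct A (range b)) (restrict_struct A (range c))"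
    using sub by (simp add: independent_substructures_def restrict_struct_def indep_independent_from)
  with elem_b elem_c show ?thesis by blast
qed

end

theorem theorem3p2:
  fixes \<sigma> :: "'r signature" and A :: "('a, 'r) fo_struct"
  assumes "countable (dom \<sigma>)"
    and "is_struct \<sigma> A"
    and "countable (carrier A)"
    and "homogeneous A"
    and "omega_categorical \<sigma> A"
    and "ramsey \<sigma> A"
  shows "\<exists>B C. elementary_substructure \<sigma> B A \<and> elementary_substructure \<sigma> C A \<and>
           independent_substructures \<sigma> A B C"
proof (cases "carrier A = {}")
  case True
  \<comment> \<open>The locales exclude the empty structure, which has no assignments; it is independent from itself.\<close>
  have "restrict_struct A (carrier A) = A"
    using assms(2) by (auto simp: restrict_struct_def is_struct_def intro!: fo_struct.equality)
  then have "elementary_substructure \<sigma> A A"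
    by (simp add: elementary_substructure_def substructure_def)
  moreover have "independent_from \<sigma> A (carrier A) (carrier A)"
    using True by (simp add: independent_from_def)
  ultimately show ?thesis unfolding independent_substructures_def by blast
next
  case False
  interpret ramsey_structure \<sigma> A by unfold_locales (use assms False in auto)
  show ?thesis by (rule independent_elementary_substructures)
qed

end
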